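(* Let $\alpha\in\mathbb{R}\setminus\{0\}$, let the background density $\rho_b$ be time-independent ($\partial_t\rho_b\equiv0$), let there be no external force, and let $[\rho_h^{n},\mathbf m_h^{n},\mathcal E_h^{n},\varphi_h^{n}]$ be a discrete state satisfying $\varrho_i^n>0$ and $\mathcal E_i^n-\frac{|\mathbf M_i^n|^2}{2\varrho_i^n}>0$ for all $i\in\mathcal V$. Let $\widetilde{\mathcal E}_h^{n+1}$ and $\widetilde\varphi_h^{n+1}$ be the total mechanical energy and the potential produced by the Gauss-law restart procedure with artificial relaxation defined in the context (using either the Yanenko or the Strang splitting in its first step). If $\delta E_P<E_{k,P}$ for every patch $P\in\breve{\mathcal T}$, then $$\sum_{i\in\mathcal V} m_i\,\widetilde{\mathcal E}_i^{n+1}+\frac{1}{2\alpha}\|\nabla\widetilde\varphi_h^{n+1}\|_{L^2(\Omega)}^2\;\le\;\sum_{i\in\mathcal V} m_i\,\mathcal E_i^{n}+\frac{1}{2\alpha}\|\nabla\varphi_h^{n}\|_{L^2(\Omega)}^2 .$$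
   Context: **Spaces.** $\Omega\subset\mathbb{R}^d$ is a bounded domain with mesh $\mathcal T_h$; every element $K$ is the image of a reference element $\widehat K$ under a diffeomorphism $T_K$. One of two settings is used. Setting (S): $\widehat K$ is the unit simplex, all $T_K$ are affine, and $\widehat P=\mathbb P^1(\widehat K)$. Setting (Q): $\widehat K$ is the unit square/cube, and $\widehat P=\mathbb Q^1(\widehat K)$. Let $\mathbb H_h=\{\omega\in C^0(\Omega):\omega\circ T_K\in\widehat P\ \forall K\}$ (potential space; or its subspace encoding periodic or homogeneous Dirichlet boundary conditions, when these are imposed on the potential), $\mathbb V_h=\{z\in L^2(\Omega): z\circ T_K\in\widehat P\ \forall K\}$ (discontinuous), $\mathbf V_h=[\mathbb V_h]^d$. Let $\{\phi_i\}_{i\in\mathcal V}$ be the nodal Lagrange basis of $\mathbb V_h$ associated with the vertices of the elements (each $i\in\mathcal V$ belongs to exactly one element and has node $\mathbf x_i$), and $m_i=\int_\Omega\phi_i\,dx$. Functions $\rho_h,\mathcal E_h\in\mathbb V_h$, $\mathbf m_h\in\mathbf V_h$ have nodal coefficients $\varrho_i,\mathcal E_i\in\mathbb R$, $\mathbf M_i\in\mathbb R^d$. For functions $f,g$ that are continuous on each closed element (scalar- or vector-valued), the lumped product is $\langle f,g\rangle=\sum_{i\in\mathcal V} m_i\, f(\mathbf x_i)\cdot g(\mathbf x_i)$, where point values at $\mathbf x_i$ are taken from within the element to which $i$ belongs. $(\cdot,\cdot)$ is the $L^2(\Omega)$ inner product. **Bilinear forms.** Setting (S): $a^\pm_{\tau}(\varphi,\omega)=(\nabla\varphi,\nabla\omega)\pm\frac{\tau^2\alpha}{4}(\rho_h\nabla\varphi,\nabla\omega)$.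 Setting (Q): $a^\pm_{\tau}(\varphi,\omega)=(\nabla\varphi,\nabla\omega)\pm\frac{\tau^2\alpha}{4}\langle\rho_h\nabla\varphi,\nabla\omega\rangle$. Here $\rho_h$ is the density passed to the source update. **Hyperbolic update** with step $\tau$. A map $\{\rho_h,\mathbf m_h,\mathcal E_h\}\mapsto\{\rho_h',\mathbf m_h',\mathcal E_h'\}$ for the compressible Euler equations (with periodic or reflecting boundary conditions), leaving the potential unchanged, and assumed to satisfy: if $\varrho_i>0$ and $\mathcal E_i-\frac{|\mathbf M_i|^2}{2\varrho_i}>0$ for all $i$, then the same holds for the output; and $\sum_i m_i\mathcal E_i'=\sum_i m_i\mathcal E_i$. **Source update** with step $\tau$ (no external force), from input $\{\rho_h,\mathbf m_h,\mathcal E_h,\varphi_h\}$ to output $\{\rho_h',\mathbf m_h',\mathcal E_h',\varphi_h'\}$: (1) set $\mathbf V_i=\mathbf M_i/\varrho_i$, $\mathbf v_h=\sum_i\mathbf V_i\phi_i$, and let $\varphi_h'\in\mathbb H_h$ be a solution of $a^+_\tau(\varphi_h',\omega)=a^-_\tau(\varphi_h,\omega)+\tau\alpha\langle\rho_h\mathbf v_h,\nabla\omega\rangle$ for all $\omega\in\mathbb H_h$; (2) $\mathbf V_i'=\mathbf V_i-\frac{\tau}{2}(\nabla\varphi_h'+\nabla\varphi_h)(\mathbf x_i)$; (3) $\varrho_i'=\varrho_i$, $\mathbf M_i'=\varrho_i\mathbf V_i'$; (4) $\mathcal E_i'=\mathcal E_i+\frac{1}{2\varrho_i'}(|\mathbf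 M_i'|^2-|\mathbf M_i|^2)$. **Splittings** (time step $\tau_n>0$). Yanenko: hyperbolic update with step $\tau_n$, then source update with step $\tau_n$. Strang: hyperbolic update with step $\tau_n$, then source update with step $2\tau_n$, then hyperbolic update with step $\tau_n$. **Gauss-law restart with artificial relaxation.** Let $\tau_{\mathrm{rel}}\in(0,\infty]$ be the physical relaxation time and let $\breve{\mathcal T}$ be a partition of $\Omega$ into patches $P$, each a union of elements of $\mathcal T_h$; write $i\in P$ if the element to which $i$ belongs is contained in $P$. 1. Apply the Yanenko or Strang splitting to $[\rho_h^{n},\mathbf m_h^{n},\mathcal E_h^{n},\varphi_h^{n}]$, giving $[\rho_h^{n+1},\mathbf m_h^{n+1},\mathcal E_h^{n+1},\varphi_h^{n+1}]$. 2. Let $\widetilde\varphi_h^{n+1}\in\mathbb H_h$ be a solution of $(\nabla\widetilde\varphi_h^{n+1},\nabla\omega)=\alpha\langle\rho_h^{n+1}+\rho_b,\omega\rangle$ for all $\omega\in\mathbb H_h$. For each patch $P$ set $$\delta E_P=\tfrac{1}{2\alpha}\big(\|\nabla\widetilde\varphi_h^{n+1}\|_{L^2(P)}^2-\|\nabla\varphi_h^{n+1}\|_{L^2(P)}^2\big),\quad E_{k,P}=\sum_{i\in P}m_i\frac{|\mathbf M_i^{n+1}|^2}{2\varrho_i^{n+1}},\quad \lambda_P^{n+1}=-\frac{1}{2\tau_n}\ln\Big[1-\Big(\frac{\delta E_P}{E_{k,P}}\Big)_+\Big],$$ where $(x)_+=\max(x,0)$ (so $\lambda_P^{n+1}=0$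 whenever $\delta E_P\le 0$). 3. With $\tau_P=\min\big(\tau_{\mathrm{rel}},(\lambda_P^{n+1})^{-1}\big)$ (where $0^{-1}=+\infty$, $e^{-\tau_n/\infty}=1$), set for every patch $P$ and every $i\in P$: $\widetilde{\mathbf M}_i^{n+1}=e^{-\tau_n/\tau_P}\mathbf M_i^{n+1}$, $\widetilde\varrho_i^{n+1}=\varrho_i^{n+1}$, and $\widetilde{\mathcal E}_i^{n+1}=\mathcal E_i^{n+1}+\frac{1}{2\varrho_i^{n+1}}\big(|\widetilde{\mathbf M}_i^{n+1}|^2-|\mathbf M_i^{n+1}|^2\big)$. The new potential is $\widetilde\varphi_h^{n+1}$ from step 2. *)

theory Defs
  imports "HOL-Analysis.Analysis"
begin

section \<open>Reference elements and local polynomial spaces\<close>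

text \<open>\<^term>\<open>Simplicial\<close> is setting (S), \<^term>\<open>Tensor\<close> is setting (Q). The spatial dimension is
  the dimension of the Euclidean space \<^typ>\<open>'a\<close>.\<close>

datatype setting = Simplicial | Tensor

fun ref_elem :: "setting \<Rightarrow> 'a::euclidean_space set" where
  "ref_elem Simplicial = convex hull (insert 0 Basis)"
| "ref_elem Tensor = cbox 0 One"

fun ref_vertices :: "setting \<Rightarrow> 'a::euclidean_space set" where
  "ref_vertices Simplicial = insert 0 Basis"
| "ref_vertices Tensor = {v. \<forall>b\<in>Basis. v \<bullet> b = 0 \<or> v \<bullet> b = 1}"

fun ref_space :: "setting \<Rightarrow> ('a::euclidean_space \<Rightarrow> real) set" where
  "ref_space Simplicial = {p. \<exists>c a. \<forall>x. p x = c + a \<bullet> x}"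
| "ref_space Tensor =
     {p. \<exists>c. \<forall>x. p x = (\<Sum>B\<in>Pow Basis. c B * (\<Prod>b\<in>B. x \<bullet> b))}"

definition ref_lagrange :: "setting \<Rightarrow> 'a::euclidean_space \<Rightarrow> 'a \<Rightarrow> real" where
  "ref_lagrange S v =
     (THE p. p \<in> ref_space S \<and> (\<forall>w\<in>ref_vertices S. p w = (if w = v then 1 else 0)))"


section \<open>Meshes\<close>

definition C1_on :: "('a::euclidean_space \<Rightarrow> 'b::euclidean_space) \<Rightarrow> 'a set \<Rightarrow> bool" where
  "C1_on f S \<longleftrightarrow>
     (\<exists>f' :: 'a \<Rightarrow> 'a \<Rightarrow>\<^sub>L 'b. continuous_on S f' \<and>
        (\<forall>x\<in>S. (f has_derivative blinfun_apply (f' x)) (at x within S)))"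

definition diffeomorphism_onto ::
  "('a::euclidean_space \<Rightarrow> 'a) \<Rightarrow> 'a set \<Rightarrow> 'a set \<Rightarrow> bool" where
  "diffeomorphism_onto T S K \<longleftrightarrow>
     T ` S = K \<and> inj_on T S \<and> C1_on T S \<and> C1_on (the_inv_into S T) K"

record 'a mesh =
  region :: "'a set"
  kind :: setting
  elements :: "'a set set"
  refmap :: "'a set \<Rightarrow> 'a \<Rightarrow> 'a"

text \<open>Elements are closed sets; they cover the closure of the domain and overlap only along
  their boundaries.\<close>

definition is_mesh :: "'a::euclidean_space mesh \<Rightarrow> bool" where
  "is_mesh M \<longleftrightarrow>
     open (region M) \<and> connected (region M) \<and> bounded (region M) \<and> region M \<noteq> {} \<and>
     finite (elements M) \<and> \<Union> (elements M) = closure (region M) \<and>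
     (\<forall>K\<in>elements M. interior K \<subseteq> region M) \<and>
     (\<forall>K\<in>elements M. \<forall>K'\<in>elements M. K \<noteq> K' \<longrightarrow> interior K \<inter> interior K' = {}) \<and>
     (\<forall>K\<in>elements M. diffeomorphism_onto (refmap M K) (ref_elem (kind M)) K) \<and>
     (kind M = Simplicial \<longrightarrow>
        (\<forall>K\<in>elements M. \<exists>A b. linear A \<and>
           (\<forall>x\<in>ref_elem (kind M). refmap M K x = A x + b)))"

text \<open>Patches are closed sets, so ``partition'' is up to patch boundaries.\<close>

definition patch_partition :: "'a::euclidean_space mesh \<Rightarrow> 'a set set \<Rightarrow> bool" where
  "patch_partition M \<P> \<longleftrightarrow>
     (\<forall>P\<in>\<P>. \<exists>S. S \<noteq> {} \<and> S \<subseteq> elements M \<and> P = \<Union> S) \<and>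
     \<Union> \<P> = closure (region M) \<and>
     (\<forall>P\<in>\<P>. \<forall>Q\<in>\<P>. P \<noteq> Q \<longrightarrow> interior P \<inter> interior Q = {})"


section \<open>Integrals, gradients and values from within an element\<close>

definition l2_inner ::
  "'a::euclidean_space set \<Rightarrow> ('a \<Rightarrow> 'b::real_inner) \<Rightarrow> ('a \<Rightarrow> 'b) \<Rightarrow> real" where
  "l2_inner S f g = (LINT x:S|lebesgue. f x \<bullet> g x)"

definition l2_norm :: "'a::euclidean_space set \<Rightarrow> ('a \<Rightarrow> 'b::real_inner) \<Rightarrow> real" where
  "l2_norm S f = sqrt (l2_inner S f f)"

text \<open>The classical gradient. A continuous piecewise smooth function has it off the element
  boundaries, a null set, and there it is the weak gradient; its (unspecified) value on the
  element boundaries is never used, because point values are taken as limits from the interior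
  of an element.\<close>

definition grad :: "('a::euclidean_space \<Rightarrow> real) \<Rightarrow> 'a \<Rightarrow> 'a" where
  "grad f x = (THE g. GDERIV f x :> g)"

definition value_in ::
  "'a::euclidean_space set \<Rightarrow> ('a \<Rightarrow> 'b::real_normed_vector) \<Rightarrow> 'a \<Rightarrow> 'b" where
  "value_in K f x = Lim (at x within interior K) f"

text \<open>Continuity on each closed element, for functions given up to values on element
  boundaries.\<close>

definition elementwise_continuous ::
  "'a::euclidean_space mesh \<Rightarrow> ('a \<Rightarrow> 'b::real_normed_vector) \<Rightarrow> bool" where
  "elementwise_continuous M f \<longleftrightarrow>
     (\<forall>K\<in>elements M. \<exists>g. continuous_on K g \<and> (\<forall>x\<in>interior K. f x = g x))"


section \<open>Nodal basis and finite element spaces\<close>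

text \<open>A node is a pair of an element and one of its vertices, so a vertex shared by several
  elements gives one node for each of them.\<close>

type_synonym 'a node = "'a set \<times> 'a"

definition nodes :: "'a::euclidean_space mesh \<Rightarrow> 'a node set" where
  "nodes M = (SIGMA K:elements M. refmap M K ` ref_vertices (kind M))"

definition basis_fun :: "'a::euclidean_space mesh \<Rightarrow> 'a node \<Rightarrow> 'a \<Rightarrow> real" where
  "basis_fun M = (\<lambda>(K, v) x.
     let R = the_inv_into (ref_elem (kind M)) (refmap M K)
     in if x \<in> interior K then ref_lagrange (kind M) (R v) (R x) else 0)"

definition mass :: "'a::euclidean_space mesh \<Rightarrow> 'a node \<Rightarrow> real" where
  "mass M i = (LINT x:region M|lebesgue. basis_fun M i x)"

text \<open>The discontinuous finite element function with given scalar or vector nodal coefficients.\<close>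

definition fe_fun ::
  "'a::euclidean_space mesh \<Rightarrow> ('a node \<Rightarrow> 'b::real_vector) \<Rightarrow> 'a \<Rightarrow> 'b" where
  "fe_fun M c x = (\<Sum>i\<in>nodes M. basis_fun M i x *\<^sub>R c i)"

definition lumped ::
  "'a::euclidean_space mesh \<Rightarrow> ('a \<Rightarrow> 'b::real_inner) \<Rightarrow> ('a \<Rightarrow> 'b) \<Rightarrow> real" where
  "lumped M f g =
     (\<Sum>i\<in>nodes M. mass M i * (value_in (fst i) f (snd i) \<bullet> value_in (fst i) g (snd i)))"

text \<open>Membership in the discontinuous space, again up to values on element boundaries; square
  integrability is automatic.\<close>

definition broken_space :: "'a::euclidean_space mesh \<Rightarrow> ('a \<Rightarrow> real) set" where
  "broken_space M =
     {z. \<forall>K\<in>elements M. \<exists>p\<in>ref_space (kind M).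
           \<forall>x\<in>interior (ref_elem (kind M)). z (refmap M K x) = p x}"

text \<open>Boundary conditions imposed on the potential space: none, homogeneous Dirichlet, or
  periodic with a given set of period vectors.\<close>

datatype 'a potential_bc = No_BC | Dirichlet | Periodic "'a set"

fun bc_holds :: "'a::euclidean_space set \<Rightarrow> 'a potential_bc \<Rightarrow> ('a \<Rightarrow> real) \<Rightarrow> bool" where
  "bc_holds D No_BC \<omega> \<longleftrightarrow> True"
| "bc_holds D Dirichlet \<omega> \<longleftrightarrow>
     (\<exists>w. continuous_on (closure D) w \<and> (\<forall>x\<in>D. w x = \<omega> x) \<and> (\<forall>x\<in>frontier D. w x = 0))"
| "bc_holds D (Periodic L) \<omega> \<longleftrightarrow>
     (\<exists>w. continuous_on (closure D) w \<and> (\<forall>x\<in>D. w x = \<omega> x) \<and>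
        (\<forall>x\<in>frontier D. \<forall>y\<in>frontier D. y - x \<in> L \<longrightarrow> w x = w y))"

definition potential_space ::
  "'a::euclidean_space mesh \<Rightarrow> 'a potential_bc \<Rightarrow> ('a \<Rightarrow> real) set" where
  "potential_space M bc =
     {\<omega> \<in> broken_space M. continuous_on (region M) \<omega> \<and> bc_holds (region M) bc \<omega>}"


section \<open>Hyperbolic and source updates\<close>

text \<open>Density, momentum and total mechanical energy, given by their nodal coefficients.\<close>

record 'a flow =
  dens :: "'a node \<Rightarrow> real"
  mom :: "'a node \<Rightarrow> 'a"
  ener :: "'a node \<Rightarrow> real"

definition admissible :: "'a::euclidean_space mesh \<Rightarrow> 'a flow \<Rightarrow> bool" where
  "admissible M U \<longleftrightarrow>
     (\<forall>i\<in>nodes M. dens U i > 0 \<and> ener U i - (norm (mom U i))\<^sup>2 / (2 * dens U i) > 0)"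

text \<open>The scheme for the Euler equations enters only through these two properties. Both are
  required on admissible states only, where such a scheme is defined.\<close>

definition hyperbolic_update ::
  "'a::euclidean_space mesh \<Rightarrow> ('a flow \<Rightarrow> 'a flow) \<Rightarrow> bool" where
  "hyperbolic_update M H \<longleftrightarrow>
     (\<forall>U. admissible M U \<longrightarrow>
        admissible M (H U) \<and>
        (\<Sum>i\<in>nodes M. mass M i * ener (H U) i) = (\<Sum>i\<in>nodes M. mass M i * ener U i))"

text \<open>The sign in the bilinear forms is the argument \<open>\<sigma>\<close>, equal to 1 or -1, and
  \<open>\<rho>\<close> is the density coefficient vector passed to the source update.\<close>

definition a_form ::
  "'a::euclidean_space mesh \<Rightarrow> real \<Rightarrow> real \<Rightarrow> real \<Rightarrow> ('a node \<Rightarrow> real) \<Rightarrow>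
     ('a \<Rightarrow> real) \<Rightarrow> ('a \<Rightarrow> real) \<Rightarrow> real" where
  "a_form M \<alpha> \<tau> \<sigma> \<rho> \<phi> \<omega> =
     l2_inner (region M) (grad \<phi>) (grad \<omega>) +
     \<sigma> * (\<tau>\<^sup>2 * \<alpha> / 4) *
       (case kind M of
          Simplicial \<Rightarrow> l2_inner (region M) (\<lambda>x. fe_fun M \<rho> x *\<^sub>R grad \<phi> x) (grad \<omega>)
        | Tensor \<Rightarrow> lumped M (\<lambda>x. fe_fun M \<rho> x *\<^sub>R grad \<phi> x) (grad \<omega>))"

text \<open>The updates are relations, since solutions of the discrete potential equations are not
  assumed to be unique.\<close>

definition source_update ::
  "'a::euclidean_space mesh \<Rightarrow> 'a potential_bc \<Rightarrow> real \<Rightarrow> real \<Rightarrow>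
     'a flow \<Rightarrow> ('a \<Rightarrow> real) \<Rightarrow> 'a flow \<Rightarrow> ('a \<Rightarrow> real) \<Rightarrow> bool" where
  "source_update M bc \<alpha> \<tau> U \<phi> U' \<phi>' \<longleftrightarrow>
     (let V = (\<lambda>i. mom U i /\<^sub>R dens U i);
          v = fe_fun M V;
          V' = (\<lambda>i. V i - (\<tau> / 2) *\<^sub>R value_in (fst i) (\<lambda>x. grad \<phi>' x + grad \<phi> x) (snd i))
      in \<phi>' \<in> potential_space M bc \<and>
         (\<forall>\<omega>\<in>potential_space M bc.
            a_form M \<alpha> \<tau> 1 (dens U) \<phi>' \<omega> =
              a_form M \<alpha> \<tau> (-1) (dens U) \<phi> \<omega>
              + \<tau> * \<alpha> * lumped M (\<lambda>x. fe_fun M (dens U) x *\<^sub>R v x) (grad \<omega>)) \<and>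
         (\<forall>i\<in>nodes M.
            dens U' i = dens U i \<and>
            mom U' i = dens U i *\<^sub>R V' i \<and>
            ener U' i = ener U i +
              1 / (2 * dens U' i) * ((norm (mom U' i))\<^sup>2 - (norm (mom U i))\<^sup>2)))"

datatype splitting = Yanenko | Strang

text \<open>\<open>hyp \<tau>\<close> is the hyperbolic update with step \<open>\<tau>\<close>.\<close>

fun split_step ::
  "'a::euclidean_space mesh \<Rightarrow> 'a potential_bc \<Rightarrow> real \<Rightarrow> (real \<Rightarrow> 'a flow \<Rightarrow> 'a flow) \<Rightarrow> real \<Rightarrow>
     splitting \<Rightarrow> 'a flow \<Rightarrow> ('a \<Rightarrow> real) \<Rightarrow> 'a flow \<Rightarrow> ('a \<Rightarrow> real) \<Rightarrow> bool" where
  "split_step M bc \<alpha> hyp \<tau> Yanenko U \<phi> U' \<phi>' \<longleftrightarrow>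
     source_update M bc \<alpha> \<tau> (hyp \<tau> U) \<phi> U' \<phi>'"
| "split_step M bc \<alpha> hyp \<tau> Strang U \<phi> U' \<phi>' \<longleftrightarrow>
     (\<exists>U2. source_update M bc \<alpha> (2 * \<tau>) (hyp \<tau> U) \<phi> U2 \<phi>' \<and> U' = hyp \<tau> U2)"


section \<open>Gauss-law restart with artificial relaxation\<close>

text \<open>The background density \<open>\<rho>b\<close> is a function of space alone, i.e. constant in time.\<close>

definition gauss_law ::
  "'a::euclidean_space mesh \<Rightarrow> 'a potential_bc \<Rightarrow> real \<Rightarrow> ('a \<Rightarrow> real) \<Rightarrow> ('a node \<Rightarrow> real) \<Rightarrow>
     ('a \<Rightarrow> real) \<Rightarrow> bool" where
  "gauss_law M bc \<alpha> \<rho>b \<rho> \<phi> \<longleftrightarrow>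
     \<phi> \<in> potential_space M bc \<and>
     (\<forall>\<omega>\<in>potential_space M bc.
        l2_inner (region M) (grad \<phi>) (grad \<omega>) = \<alpha> * lumped M (\<lambda>x. fe_fun M \<rho> x + \<rho>b x) \<omega>)"

definition delta_E :: "real \<Rightarrow> 'a::euclidean_space set \<Rightarrow> ('a \<Rightarrow> real) \<Rightarrow> ('a \<Rightarrow> real) \<Rightarrow> real" where
  "delta_E \<alpha> P \<phi>new \<phi>old =
     1 / (2 * \<alpha>) * ((l2_norm P (grad \<phi>new))\<^sup>2 - (l2_norm P (grad \<phi>old))\<^sup>2)"

definition patch_nodes :: "'a::euclidean_space mesh \<Rightarrow> 'a set \<Rightarrow> 'a node set" where
  "patch_nodes M P = {i \<in> nodes M. fst i \<subseteq> P}"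

definition E_kin :: "'a::euclidean_space mesh \<Rightarrow> 'a flow \<Rightarrow> 'a set \<Rightarrow> real" where
  "E_kin M U P = (\<Sum>i\<in>patch_nodes M P. mass M i * ((norm (mom U i))\<^sup>2 / (2 * dens U i)))"

text \<open>If the kinetic energy \<open>Ek\<close> vanishes and \<open>dE\<close> is negative, the quotient is 0 by the
  convention for division by zero, so the rate is 0, as it should be whenever \<open>dE \<le> 0\<close>.\<close>

definition relax_rate :: "real \<Rightarrow> real \<Rightarrow> real \<Rightarrow> real" where
  "relax_rate \<tau> dE Ek = - (1 / (2 * \<tau>)) * ln (1 - max (dE / Ek) 0)"

text \<open>Extended reals: there the inverse of 0 is \<open>\<infinity>\<close>, and a real divided by \<open>\<infinity>\<close> is 0.\<close>

definition relax_time :: "ereal \<Rightarrow> real \<Rightarrow> ereal" where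
  "relax_time \<tau>rel r = min \<tau>rel (inverse (ereal r))"

definition relax_factor :: "real \<Rightarrow> ereal \<Rightarrow> real" where
  "relax_factor \<tau> \<tau>P = exp (- real_of_ereal (ereal \<tau> / \<tau>P))"

text \<open>\<open>(U, \<phi>)\<close> is the old state, \<open>(U1, \<phi>1)\<close> the state after the splitting, \<open>(Ut, \<phi>t)\<close> the
  restarted state.\<close>

definition restart_step ::
  "'a::euclidean_space mesh \<Rightarrow> 'a potential_bc \<Rightarrow> real \<Rightarrow> ('a \<Rightarrow> real) \<Rightarrow> ereal \<Rightarrow> 'a set set \<Rightarrow>
     (real \<Rightarrow> 'a flow \<Rightarrow> 'a flow) \<Rightarrow> real \<Rightarrow> splitting \<Rightarrow>
     'a flow \<Rightarrow> ('a \<Rightarrow> real) \<Rightarrow> 'a flow \<Rightarrow> ('a \<Rightarrow> real) \<Rightarrow> 'a flow \<Rightarrow> ('a \<Rightarrow> real) \<Rightarrow> bool" where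
  "restart_step M bc \<alpha> \<rho>b \<tau>rel \<P> hyp \<tau> spl U \<phi> U1 \<phi>1 Ut \<phi>t \<longleftrightarrow>
     split_step M bc \<alpha> hyp \<tau> spl U \<phi> U1 \<phi>1 \<and>
     gauss_law M bc \<alpha> \<rho>b (dens U1) \<phi>t \<and>
     (\<forall>P\<in>\<P>. \<forall>i\<in>patch_nodes M P.
        mom Ut i =
          relax_factor \<tau>
            (relax_time \<tau>rel (relax_rate \<tau> (delta_E \<alpha> P \<phi>t \<phi>1) (E_kin M U1 P))) *\<^sub>R mom U1 i \<and>
        dens Ut i = dens U1 i \<and>
        ener Ut i = ener U1 i +
          1 / (2 * dens U1 i) * ((norm (mom Ut i))\<^sup>2 - (norm (mom U1 i))\<^sup>2))"

end

(* A source update conserves nodal total energy plus field energy: testing the potential equation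
   with the sum of the old and the new potential gives the change of field energy as a lumped sum
   which is exactly minus the change of kinetic energy (in setting (S) because the gradients are
   elementwise constant and the density is elementwise linear, in setting (Q) because the form itself
   is lumped). So only the restart changes the energy, by
   (f_P^2 - 1) E_kin(P) + delta_E(P) on the patch P, where f_P is the relaxation factor; since
   f_P^2 <= 1 - max(delta_E(P) / E_kin(P), 0), this is nonpositive. *)

theory Submission
  imports Defs
begin

text \<open>The sum of the two potentials is the right test function for two reasons. By symmetry of
  the L2 form the mixed terms of the old and the new potential cancel, leaving a difference of
  squares. The opposite signs of the two density terms turn them into one square of the summed
  gradient, which is the quadratic term that the velocity update produces when the kinetic energy is
  expanded. The square of f_P appears because kinetic energy is quadratic in momentum. The 1/2 in
  \<open>relax_rate\<close> compensates for it, and the minimum with the physical relaxation time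
  can only strengthen the damping. Comparing the two sides on a patch uses E_kin(P) >= 0, hence
  nonnegative masses, hence reference basis functions that are nonnegative on the reference element.
  The technical obstacle is that gradients are known only inside the elements. So functions are
  compared on element interiors alone, nodal values are limits from there, and element boundaries
  are shown to be null sets before integrals are split.\<close>

section \<open>Reference elements\<close>

lemma compact_ref_elem: "compact (ref_elem S :: 'a::euclidean_space set)"
  by (cases S) (auto intro!: finite_imp_compact_convex_hull)

lemma convex_ref_elem: "convex (ref_elem S :: 'a::euclidean_space set)"
  by (cases S) auto

lemma interior_ref_elem_nonempty: "interior (ref_elem S :: 'a::euclidean_space set) \<noteq> {}"
proof (cases S)
  case Simplicial
  then show ?thesis using interior_std_simplex_nonempty by (metis empty_iff ref_elem.simps(1))
next
  case Tensor
  then show ?thesis by (auto simp: interior_cbox box_ne_empty)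
qed

lemma closure_interior_ref_elem:
  "closure (interior (ref_elem S :: 'a::euclidean_space set)) = ref_elem S"
  by (metis closure_closed compact_imp_closed compact_ref_elem convex_closure_interior
      convex_ref_elem interior_ref_elem_nonempty)

lemma ref_vertices_subset: "ref_vertices S \<subseteq> (ref_elem S :: 'a::euclidean_space set)"
proof (cases S)
  case Simplicial
  then show ?thesis by (simp add: hull_subset del: insert_subset)
next
  case Tensor
  then show ?thesis by (force simp: mem_box)
qed

lemma sum_Basis_inner_if:
  assumes "B \<subseteq> (Basis :: 'a::euclidean_space set)" "b \<in> Basis"
  shows "(\<Sum>B) \<bullet> b = (if b \<in> B then 1 else 0)"
proof -
  have "finite B" using assms finite_Basis infinite_super by blast
  have "(\<Sum>B) \<bullet> b = (\<Sum>i\<in>B. if i = b then 1 else 0)"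
    unfolding inner_sum_left
    by (intro sum.cong) (use assms inner_Basis in fastforce)+
  then show ?thesis using \<open>finite B\<close> by simp
qed

text \<open>The subsets of \<open>Basis\<close> also index the multilinear monomials, so with this
  description evaluation at the cube vertices becomes a square system over subsets.\<close>

lemma Tensor_vertices_eq:
  "ref_vertices Tensor = Sum ` Pow (Basis :: 'a::euclidean_space set)"
proof (intro equalityI subsetI)
  fix v :: 'a assume v: "v \<in> ref_vertices Tensor"
  have "v = \<Sum>{b\<in>Basis. v \<bullet> b = 1}"
  proof (rule euclidean_eqI)
    fix b :: 'a assume "b \<in> Basis"
    then show "v \<bullet> b = \<Sum>{b \<in> Basis. v \<bullet> b = 1} \<bullet> b"
      using v by (subst sum_Basis_inner_if) auto
  qed
  then show "v \<in> Sum ` Pow Basis" by blast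
next
  fix v :: 'a assume "v \<in> Sum ` Pow Basis"
  then show "v \<in> ref_vertices Tensor" by (auto simp: sum_Basis_inner_if)
qed

lemma finite_ref_vertices: "finite (ref_vertices S :: 'a::euclidean_space set)"
  by (cases S) (simp_all add: Tensor_vertices_eq del: ref_vertices.simps(2))

lemma ref_space_add:
  assumes "p \<in> ref_space S" "q \<in> ref_space S"
  shows "(\<lambda>x::'a::euclidean_space. p x + q x) \<in> ref_space S"
proof (cases S)
  case Simplicial
  with assms obtain c a c' a' where "\<And>x. p x = c + a \<bullet> x" "\<And>x. q x = c' + a' \<bullet> x" by auto
  then show ?thesis using Simplicial
    by (auto intro!: exI[of _ "c + c'"] exI[of _ "a + a'"] simp: inner_add_left)
next
  case Tensor
  with assms obtain c c' where
    "\<And>x. p x = (\<Sum>B\<in>Pow Basis. c B * (\<Prod>b\<in>B. x \<bullet> b))"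
    "\<And>x. q x = (\<Sum>B\<in>Pow Basis. c' B * (\<Prod>b\<in>B. x \<bullet> b))" by auto
  then show ?thesis using Tensor
    by (auto intro!: exI[of _ "\<lambda>B. c B + c' B"] simp: sum.distrib algebra_simps)
qed

lemma ref_space_uminus:
  assumes "p \<in> ref_space S"
  shows "(\<lambda>x::'a::euclidean_space. - p x) \<in> ref_space S"
proof (cases S)
  case Simplicial
  with assms obtain c a where "\<And>x. p x = c + a \<bullet> x" by auto
  then show ?thesis using Simplicial
    by (auto intro!: exI[of _ "- c"] exI[of _ "- a"])
next
  case Tensor
  with assms obtain c where
    "\<And>x. p x = (\<Sum>B\<in>Pow Basis. c B * (\<Prod>b\<in>B. x \<bullet> b))" by auto
  then show ?thesis using Tensor
    by (auto intro!: exI[of _ "\<lambda>B. - c B"] simp: sum_negf)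
qed

text \<open>Injectivity of the subset-sum transform: the system is triangular with respect to
  inclusion, so strong induction isolates \<open>c B\<close> once all proper subsets are known to
  give 0.\<close>

lemma sum_Pow_eq_0_imp_0:
  fixes c :: "'a set \<Rightarrow> real"
  assumes "finite A" "\<And>B. B \<subseteq> A \<Longrightarrow> sum c (Pow B) = 0" "B \<subseteq> A"
  shows "c B = 0"
  using finite_subset[OF \<open>B \<subseteq> A\<close> \<open>finite A\<close>] \<open>B \<subseteq> A\<close>
proof (induction B rule: finite_psubset_induct)
  case (psubset B)
  have "0 = sum c (Pow B)" using assms(2) psubset.prems by simp
  also have "\<dots> = c B + sum c (Pow B - {B})"
    using psubset.hyps by (intro sum.remove) auto
  also have "sum c (Pow B - {B}) = 0"
    by (rule sum.neutral) (use psubset in auto)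
  finally show ?case by simp
qed

text \<open>Unisolvence of the vertex values, the uniqueness half of the definite description in
  \<open>ref_lagrange\<close>. On the cube the vertex values are subset sums of the coefficients, so
  the triangular system above applies.\<close>

lemma ref_space_eq_0:
  fixes p :: "'a::euclidean_space \<Rightarrow> real"
  assumes "p \<in> ref_space S" "\<And>w. w \<in> ref_vertices S \<Longrightarrow> p w = 0"
  shows "p x = 0"
proof (cases S)
  case Simplicial
  with assms obtain c a where p: "\<And>x. p x = c + a \<bullet> x" by auto
  have "c = 0" using assms(2)[of 0] p Simplicial by simp
  moreover have "a = 0"
  proof (rule euclidean_eqI)
    fix b :: 'a assume "b \<in> Basis"
    then show "a \<bullet> b = 0 \<bullet> b"
      using assms(2)[of b] p[of b] Simplicial \<open>c = 0\<close> by simp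
  qed
  ultimately show ?thesis using p by simp
next
  case Tensor
  with assms obtain c where
    p: "\<And>x. p x = (\<Sum>B\<in>Pow Basis. c B * (\<Prod>b\<in>B. x \<bullet> b))" by auto
  have "c B = 0" if "B \<subseteq> Basis" for B
  proof (rule sum_Pow_eq_0_imp_0[OF finite_Basis _ that])
    fix A :: "'a set" assume A: "A \<subseteq> Basis"
    \<comment> \<open>At the vertex \<open>\<Sum>A\<close> a monomial is 1 if all its factors come from \<open>A\<close>, and 0 otherwise.\<close>
    have "sum c (Pow A) = (\<Sum>B\<in>Pow Basis. if B \<subseteq> A then c B else 0)"
      using A by (intro sum.mono_neutral_cong_left) auto
    also have "\<dots> = (\<Sum>B\<in>Pow Basis. c B * (\<Prod>b\<in>B. (\<Sum>A) \<bullet> b))"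
    proof (rule sum.cong)
      fix B :: "'a set" assume B: "B \<in> Pow Basis"
      then have fin: "finite B" using finite_Basis infinite_super by blast
      have "(\<Prod>b\<in>B. (\<Sum>A) \<bullet> b) = (\<Prod>b\<in>B. if b \<in> A then 1 else 0)"
        by (rule prod.cong) (use A B in \<open>auto simp: sum_Basis_inner_if subset_eq\<close>)
      also have "\<dots> = (if B \<subseteq> A then 1 else 0)"
        using fin by (auto intro!: prod.neutral)
      finally show "(if B \<subseteq> A then c B else 0) = c B * (\<Prod>b\<in>B. (\<Sum>A) \<bullet> b)" by simp
    qed simp
    also have "\<dots> = p (\<Sum>A)" using p by simp
    also have "\<dots> = 0" 
      using A Tensor by (intro assms(2)) (auto simp: Tensor_vertices_eq simp del: ref_vertices.simps(2))
    finally show "sum c (Pow A) = 0" .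
  qed
  then show ?thesis using p by simp
qed

text \<open>Expanding the product, the set of factors that contribute their linear term determines
  the monomial. The cube's Lagrange functions have this product form.\<close>

lemma prod_affine_in_ref_space:
  "(\<lambda>x::'a::euclidean_space. \<Prod>b\<in>Basis. s b * (x \<bullet> b) + t b) \<in> ref_space Tensor"
proof -
  have "(\<Prod>b\<in>Basis. s b * (x \<bullet> b) + t b) =
      (\<Sum>B\<in>Pow Basis. (prod s B * prod t (Basis - B)) * (\<Prod>b\<in>B. x \<bullet> b))" for x :: 'a
    by (subst prod_add) (auto simp: prod.distrib algebra_simps)
  then show ?thesis by auto
qed

text \<open>The witnesses are the barycentric coordinates on the simplex and products of
  one-dimensional hat functions on the cube. Nonnegativity is recorded here because the signs of the
  masses depend on it.\<close>

lemma ref_lagrange_exists: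
  assumes "v \<in> ref_vertices S"
  shows "\<exists>p\<in>ref_space S. (\<forall>w\<in>ref_vertices S. p w = (if w = v then 1 else 0)) \<and>
    (\<forall>x\<in>ref_elem S. 0 \<le> p (x::'a::euclidean_space))"
proof (cases S)
  case Simplicial
  show ?thesis
  proof (cases "v = 0")
    case True
    let ?p = "\<lambda>x::'a. 1 + (- One) \<bullet> x"
    have "?p \<in> ref_space S" unfolding Simplicial ref_space.simps by blast
    moreover have "?p w = (if w = v then 1 else 0)" if "w \<in> ref_vertices S" for w
      using that Simplicial True by (auto simp: inner_sum_left_Basis)
    moreover have "0 \<le> ?p x" if "x \<in> ref_elem S" for x
      using that Simplicial by (auto simp: std_simplex inner_sum_right inner_commute[of One])
    ultimately show ?thesis by (intro bexI[of _ ?p]) auto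
  next
    case False
    then have v: "v \<in> Basis" using assms Simplicial by simp
    let ?p = "\<lambda>x::'a. 0 + v \<bullet> x"
    have "?p \<in> ref_space S" unfolding Simplicial ref_space.simps by blast
    moreover have "?p w = (if w = v then 1 else 0)" if "w \<in> ref_vertices S" for w
      using that Simplicial False v by (auto simp: inner_Basis)
    moreover have "0 \<le> ?p x" if "x \<in> ref_elem S" for x
      using that Simplicial v by (auto simp: std_simplex inner_commute)
    ultimately show ?thesis by (intro bexI[of _ ?p]) auto
  qed
next
  case Tensor
  \<comment> \<open>The factor for \<open>b\<close> is the coordinate itself if \<open>v\<close> has
    coordinate 1 there, and one minus the coordinate otherwise. It is 1 at \<open>v\<close> and 0 at
    any vertex that differs from \<open>v\<close> in direction \<open>b\<close>.\<close>
  define s where "s b = (if v \<bullet> b = 1 then 1 else -1 :: real)" for b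
  define t where "t b = (if v \<bullet> b = 1 then 0 else 1 :: real)" for b
  let ?p = "\<lambda>x::'a. \<Prod>b\<in>Basis. s b * (x \<bullet> b) + t b"
  have "?p \<in> ref_space S" using prod_affine_in_ref_space Tensor by blast
  moreover have "?p w = (if w = v then 1 else 0)" if w: "w \<in> ref_vertices S" for w
  proof (cases "w = v")
    case True
    then show ?thesis using w Tensor by (auto simp: s_def t_def intro!: prod.neutral)
  next
    case False
    then obtain b where "b \<in> Basis" "w \<bullet> b \<noteq> v \<bullet> b" using euclidean_eqI by blast
    moreover then have "s b * (w \<bullet> b) + t b = 0"
      using w assms Tensor by (fastforce simp: s_def t_def)
    ultimately show ?thesis using False by auto
  qed
  moreover have "0 \<le> ?p x" if "x \<in> ref_elem S" for x
    using that Tensor by (auto simp: s_def t_def mem_box intro!: prod_nonneg)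
  ultimately show ?thesis by (intro bexI[of _ ?p]) auto
qed

lemma ref_lagrange:
  fixes v :: "'a::euclidean_space"
  assumes "v \<in> ref_vertices S"
  shows ref_lagrange_in_ref_space: "ref_lagrange S v \<in> ref_space S"
    and ref_lagrange_vertex:
      "w \<in> ref_vertices S \<Longrightarrow> ref_lagrange S v w = (if w = v then 1 else 0)"
    and ref_lagrange_nonneg: "x \<in> ref_elem S \<Longrightarrow> 0 \<le> ref_lagrange S v x"
proof -
  obtain p where p: "p \<in> ref_space S" "\<And>w. w \<in> ref_vertices S \<Longrightarrow> p w = (if w = v then 1 else 0)"
      "\<And>x. x \<in> ref_elem S \<Longrightarrow> 0 \<le> p x"
    using ref_lagrange_exists[OF assms] by blast
  have "ref_lagrange S v = p"
    unfolding ref_lagrange_def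
  proof (rule the_equality)
    show "p \<in> ref_space S \<and> (\<forall>w\<in>ref_vertices S. p w = (if w = v then 1 else 0))"
      using p by blast
    fix q assume q: "q \<in> ref_space S \<and> (\<forall>w\<in>ref_vertices S. q w = (if w = v then 1 else 0))"
    have "q x + - p x = 0" for x
    proof (rule ref_space_eq_0[of "\<lambda>x. q x + - p x" S])
      show "(\<lambda>x. q x + - p x) \<in> ref_space S"
        using p q by (intro ref_space_add ref_space_uminus) auto
    qed (use p q in auto)
    then show "q = p" by (auto simp: fun_eq_iff)
  qed
  then show "ref_lagrange S v \<in> ref_space S"
    "w \<in> ref_vertices S \<Longrightarrow> ref_lagrange S v w = (if w = v then 1 else 0)"
    "x \<in> ref_elem S \<Longrightarrow> 0 \<le> ref_lagrange S v x"
    using p by auto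
qed

section \<open>Continuous gradients of the reference polynomials\<close>

lemma continuous_gradient_sum:
  assumes "finite I" "\<And>i. i \<in> I \<Longrightarrow> \<exists>q. continuous_on UNIV q \<and> (\<forall>x. GDERIV (f i) x :> q x)"
  shows "\<exists>q. continuous_on UNIV q \<and> (\<forall>x. GDERIV (\<lambda>x. \<Sum>i\<in>I. f i x) x :> (q x :: 'a::real_inner))"
  using assms
proof (induction I)
  case empty
  then show ?case by (auto intro!: exI[of _ "\<lambda>_. 0"] GDERIV_const)
next
  case (insert i I)
  then obtain q r where "continuous_on UNIV q" "\<And>x. GDERIV (\<lambda>x. \<Sum>i\<in>I. f i x) x :> q x"
    "continuous_on UNIV r" "\<And>x. GDERIV (f i) x :> r x"
    by (metis insertI1 insertI2)
  then show ?case using insert.hyps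
    by (auto intro!: exI[of _ "\<lambda>x. r x + q x"] continuous_intros GDERIV_add)
qed

lemma continuous_gradient_prod:
  assumes "finite I" "\<And>i. i \<in> I \<Longrightarrow> \<exists>q. continuous_on UNIV q \<and> (\<forall>x. GDERIV (f i) x :> q x)"
  shows "\<exists>q. continuous_on UNIV q \<and> (\<forall>x. GDERIV (\<lambda>x. \<Prod>i\<in>I. f i x) x :> (q x :: 'a::real_inner))"
  using assms
proof (induction I)
  case empty
  then show ?case by (auto intro!: exI[of _ "\<lambda>_. 0"] GDERIV_const)
next
  case (insert i I)
  then obtain q r where *: "continuous_on UNIV q" "\<And>x. GDERIV (\<lambda>x. \<Prod>i\<in>I. f i x) x :> q x"
    "continuous_on UNIV r" "\<And>x. GDERIV (f i) x :> r x"
    by (metis insertI1 insertI2)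
  have cont: "continuous_on UNIV f" if "\<And>x. GDERIV f x :> q x" for f :: "'a \<Rightarrow> real" and q
    using that unfolding gderiv_def
    by (meson continuous_at_imp_continuous_on has_derivative_continuous)
  have "continuous_on UNIV (\<lambda>x. f i x *\<^sub>R q x + (\<Prod>i\<in>I. f i x) *\<^sub>R r x)"
    using * by (intro continuous_intros cont[of "f i"] cont[of "\<lambda>x. \<Prod>i\<in>I. f i x"]) auto
  moreover have "GDERIV (\<lambda>x. \<Prod>i\<in>insert i I. f i x) x :> f i x *\<^sub>R q x + (\<Prod>i\<in>I. f i x) *\<^sub>R r x" for x
    using insert.hyps GDERIV_mult[OF *(4) *(2), of x] by simp
  ultimately show ?case by blast
qed

lemma ref_space_gradient:
  fixes p :: "'a::euclidean_space \<Rightarrow> real"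
  assumes "p \<in> ref_space S"
  shows "\<exists>q. continuous_on UNIV q \<and> (\<forall>x. GDERIV p x :> q x)"
proof -
  have lin: "\<exists>q. continuous_on UNIV q \<and> (\<forall>x. GDERIV (\<lambda>x. x \<bullet> b) x :> q x)" for b :: 'a
    by (auto intro!: exI[of _ "\<lambda>_. b"] derivative_eq_intros simp: gderiv_def)
  show ?thesis
  proof (cases S)
    case Simplicial
    with assms obtain c a where "p = (\<lambda>x. c + a \<bullet> x)" by auto
    moreover have "GDERIV (\<lambda>x. c + a \<bullet> x) x :> a" for x
      unfolding gderiv_def by (auto intro!: derivative_eq_intros simp: inner_commute)
    ultimately show ?thesis by (auto intro!: exI[of _ "\<lambda>_. a"])
  next
    case Tensor
    with assms obtain c where p: "p = (\<lambda>x. \<Sum>B\<in>Pow Basis. c B * (\<Prod>b\<in>B. x \<bullet> b))" by auto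
    show ?thesis unfolding p
    proof (rule continuous_gradient_sum)
      fix B :: "'a set" assume "B \<in> Pow Basis"
      then have "finite B" using finite_Basis infinite_super by blast
      from continuous_gradient_prod[OF this, where f = "\<lambda>b x. x \<bullet> b", OF lin]
      obtain q where q: "continuous_on UNIV q" "\<And>x. GDERIV (\<lambda>x. \<Prod>b\<in>B. x \<bullet> b) x :> q x"
        by blast
      have "GDERIV (\<lambda>x. c B * (\<Prod>b\<in>B. x \<bullet> b)) x :> c B *\<^sub>R q x" for x
        using GDERIV_mult[OF GDERIV_const q(2)] by simp
      with q(1) show "\<exists>q. continuous_on UNIV q \<and>
          (\<forall>x. GDERIV (\<lambda>x. c B * (\<Prod>b\<in>B. x \<bullet> b)) x :> q x)"
        by (intro exI[of _ "\<lambda>x. c B *\<^sub>R q x"]) (auto intro!: continuous_intros)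
    qed simp
  qed
qed

lemma continuous_on_ref_space:
  fixes p :: "'a::euclidean_space \<Rightarrow> real"
  assumes "p \<in> ref_space S"
  shows "continuous_on A p"
proof -
  obtain q where "\<And>x. GDERIV p x :> q x" using ref_space_gradient[OF assms] by blast
  then show ?thesis unfolding gderiv_def
    by (meson continuous_at_imp_continuous_on has_derivative_continuous)
qed

section \<open>Gradients and potential spaces\<close>

text \<open>No integrability is assumed: the Bochner integral of a nonnegative function is
  nonnegative in any case, the default value for a non-integrable one being 0.\<close>

lemma l2_norm_power2: "(l2_norm S f)\<^sup>2 = l2_inner S f f"
proof -
  have "0 \<le> l2_inner S f f"
    unfolding l2_inner_def set_lebesgue_integral_def by (intro integral_nonneg_AE) simp
  then show ?thesis by (simp add: l2_norm_def)
qed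

lemma C1_on_imp_continuous_on: "C1_on f S \<Longrightarrow> continuous_on S f"
  unfolding C1_on_def by (auto intro: has_derivative_continuous_on)

lemma C1_on_imp_differentiable_on: "C1_on f S \<Longrightarrow> f differentiable_on S"
  unfolding C1_on_def differentiable_on_def differentiable_def by blast

lemma GDERIV_unique:
  assumes "GDERIV f x :> a" "GDERIV f x :> b"
  shows "a = b"
proof -
  have "(\<lambda>h. h \<bullet> a) = (\<lambda>h. h \<bullet> b)"
    using assms unfolding gderiv_def by (rule has_derivative_unique)
  then have "(a - b) \<bullet> a = (a - b) \<bullet> b" by metis
  then show ?thesis by (metis inner_diff_right inner_eq_zero_iff right_minus_eq)
qed

lemma grad_eqI: "GDERIV f x :> g \<Longrightarrow> grad f x = g"
  unfolding grad_def by (blast intro: GDERIV_unique)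

lemma broken_space_add:
  assumes "f \<in> broken_space M" "g \<in> broken_space M"
  shows "(\<lambda>x. f x + g x) \<in> broken_space M"
  unfolding broken_space_def
proof (intro CollectI ballI)
  fix K assume "K \<in> elements M"
  with assms obtain p q where "p \<in> ref_space (kind M)" "q \<in> ref_space (kind M)"
    "\<forall>x\<in>interior (ref_elem (kind M)). f (refmap M K x) = p x"
    "\<forall>x\<in>interior (ref_elem (kind M)). g (refmap M K x) = q x"
    unfolding broken_space_def by blast
  then show "\<exists>p\<in>ref_space (kind M). \<forall>x\<in>interior (ref_elem (kind M)).
      f (refmap M K x) + g (refmap M K x) = p x"
    by (intro bexI[of _ "\<lambda>x. p x + q x"] ref_space_add) auto
qed

text \<open>All three boundary conditions are linear, so the continuous extensions can be added.
  This is what allows the sum of the old and the new potential as a test function.\<close>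

lemma bc_holds_add:
  assumes "bc_holds D bc f" "bc_holds D bc g"
  shows "bc_holds D bc (\<lambda>x. f x + g x)"
proof (cases bc)
  case No_BC
  then show ?thesis by simp
next
  case Dirichlet
  with assms obtain v w where
    "continuous_on (closure D) v" "\<forall>x\<in>D. v x = f x" "\<forall>x\<in>frontier D. v x = 0"
    "continuous_on (closure D) w" "\<forall>x\<in>D. w x = g x" "\<forall>x\<in>frontier D. w x = 0" by auto
  then show ?thesis unfolding Dirichlet bc_holds.simps
    by (intro exI[of _ "\<lambda>x. v x + w x"]) (auto intro: continuous_on_add)
next
  case (Periodic L)
  with assms obtain v w where
    "continuous_on (closure D) v" "\<forall>x\<in>D. v x = f x"
    "\<forall>x\<in>frontier D. \<forall>y\<in>frontier D. y - x \<in> L \<longrightarrow> v x = v y"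
    "continuous_on (closure D) w" "\<forall>x\<in>D. w x = g x"
    "\<forall>x\<in>frontier D. \<forall>y\<in>frontier D. y - x \<in> L \<longrightarrow> w x = w y" by auto
  then show ?thesis unfolding Periodic bc_holds.simps
    by (intro exI[of _ "\<lambda>x. v x + w x"]) (auto intro: continuous_on_add)
qed

lemma potential_space_add:
  assumes "f \<in> potential_space M bc" "g \<in> potential_space M bc"
  shows "(\<lambda>x. f x + g x) \<in> potential_space M bc"
  using assms unfolding potential_space_def
  by (auto intro: broken_space_add continuous_on_add bc_holds_add)

lemma potential_space_subset: "potential_space M bc \<subseteq> broken_space M"
  unfolding potential_space_def by auto

section \<open>Geometry of the elements\<close>

locale fe_mesh =
  fixes M :: "'a::euclidean_space mesh"
  assumes mesh: "is_mesh M"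
begin

abbreviation ref :: "'a set" where
  "ref \<equiv> ref_elem (kind M)"

abbreviation refinv :: "'a set \<Rightarrow> 'a \<Rightarrow> 'a" where
  "refinv K \<equiv> the_inv_into ref (refmap M K)"

lemma finite_elements: "finite (elements M)"
  and Union_elements: "\<Union> (elements M) = closure (region M)"
  and interior_subset_region: "K \<in> elements M \<Longrightarrow> interior K \<subseteq> region M"
  and disjoint_interiors:
    "K \<in> elements M \<Longrightarrow> L \<in> elements M \<Longrightarrow> K \<noteq> L \<Longrightarrow> interior K \<inter> interior L = {}"
  and refmap_affine: "kind M = Simplicial \<Longrightarrow> K \<in> elements M \<Longrightarrow>
    \<exists>A b. linear A \<and> (\<forall>x\<in>ref. refmap M K x = A x + b)"
  using mesh by (simp_all add: is_mesh_def)

lemma refmap_image: "K \<in> elements M \<Longrightarrow> refmap M K ` ref = K"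
  and inj_refmap: "K \<in> elements M \<Longrightarrow> inj_on (refmap M K) ref"
  and C1_refmap: "K \<in> elements M \<Longrightarrow> C1_on (refmap M K) ref"
  and C1_refinv: "K \<in> elements M \<Longrightarrow> C1_on (refinv K) K"
  using mesh by (simp_all add: is_mesh_def diffeomorphism_onto_def)

lemma refmap_refinv: "K \<in> elements M \<Longrightarrow> x \<in> K \<Longrightarrow> refmap M K (refinv K x) = x"
  using refmap_image inj_refmap by (simp add: f_the_inv_into_f)

lemma refinv_refmap: "K \<in> elements M \<Longrightarrow> y \<in> ref \<Longrightarrow> refinv K (refmap M K y) = y"
  using inj_refmap by (simp add: the_inv_into_f_f)

lemma refinv_in_ref: "K \<in> elements M \<Longrightarrow> x \<in> K \<Longrightarrow> refinv K x \<in> ref"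
  using refmap_image inj_refmap by (metis subset_refl the_inv_into_into)

lemma inj_refinv: "K \<in> elements M \<Longrightarrow> inj_on (refinv K) K"
  by (metis inj_onI refmap_refinv)

lemma compact_element: "K \<in> elements M \<Longrightarrow> compact K"
  by (metis C1_on_imp_continuous_on C1_refmap compact_continuous_image compact_ref_elem refmap_image)

text \<open>Both \<open>refmap M K\<close> and its inverse are continuous and injective, so by
  invariance of domain each maps open sets to open sets. Each inclusion uses one of the two
  maps.\<close>

lemma interior_element:
  assumes K: "K \<in> elements M"
  shows "interior K = refmap M K ` interior ref"
proof
  have "open (refmap M K ` interior ref)"
    by (intro invariance_of_domain open_interior
        continuous_on_subset[OF C1_on_imp_continuous_on[OF C1_refmap[OF K]] interior_subset]
        inj_on_subset[OF inj_refmap[OF K] interior_subset])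
  then show "refmap M K ` interior ref \<subseteq> interior K"
    using refmap_image[OF K] interior_subset by (intro interior_maximal) blast+
  have "open (refinv K ` interior K)"
    by (intro invariance_of_domain open_interior
        continuous_on_subset[OF C1_on_imp_continuous_on[OF C1_refinv[OF K]] interior_subset]
        inj_on_subset[OF inj_refinv[OF K] interior_subset])
  then have "refinv K ` interior K \<subseteq> interior ref"
    using refinv_in_ref[OF K] interior_subset by (intro interior_maximal) blast+
  then show "interior K \<subseteq> refmap M K ` interior ref"
    using refmap_refinv[OF K] interior_subset[of K] by (force intro: rev_image_eqI)
qed

lemma refinv_interior:
  assumes "K \<in> elements M" "x \<in> interior K"
  shows "refinv K x \<in> interior ref"
proof -
  obtain y where "y \<in> interior ref" "x = refmap M K y" using assms interior_element by auto
  then show ?thesis using refinv_refmap assms interior_subset by (metis subsetD)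
qed

lemma closure_interior_element:
  assumes K: "K \<in> elements M"
  shows "closure (interior K) = K"
proof
  show "closure (interior K) \<subseteq> K"
    by (simp add: K closure_minimal compact_element compact_imp_closed interior_subset)
  have "refmap M K ` closure (interior ref) \<subseteq> closure (refmap M K ` interior ref)"
    using C1_on_imp_continuous_on[OF C1_refmap[OF K]]
    by (intro image_closure_subset) (auto simp: closure_interior_ref_elem closure_subset)
  then show "K \<subseteq> closure (interior K)"
    by (simp add: closure_interior_ref_elem refmap_image[OF K] interior_element[OF K])
qed

lemma interior_element_nonempty: "K \<in> elements M \<Longrightarrow> interior K \<noteq> {}"
  by (simp add: interior_element interior_ref_elem_nonempty)

text \<open>The boundary of a convex set is null, differentiable maps send null sets to null sets,
  and a boundary point of \<open>K\<close> can only come from a boundary point of the reference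
  element.\<close>

lemma negligible_frontier_element:
  assumes K: "K \<in> elements M"
  shows "negligible (frontier K)"
proof -
  have "frontier ref \<subseteq> ref"
    by (simp add: compact_imp_closed compact_ref_elem frontier_subset_closed)
  then have "refmap M K differentiable_on frontier ref"
    using C1_on_imp_differentiable_on[OF C1_refmap[OF K]] differentiable_on_subset by blast
  then have "negligible (refmap M K ` frontier ref)"
    by (intro negligible_differentiable_image_negligible negligible_convex_frontier convex_ref_elem) auto
  moreover have "frontier K \<subseteq> refmap M K ` frontier ref"
  proof -
    have "frontier K = refmap M K ` ref - refmap M K ` interior ref"
      using compact_element[OF K]
      by (simp add: frontier_def compact_imp_closed refmap_image[OF K] interior_element[OF K, symmetric])
    also have "\<dots> \<subseteq> refmap M K ` (ref - interior ref)"
      by blast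
    finally show ?thesis by (simp add: frontier_def compact_imp_closed compact_ref_elem)
  qed
  ultimately show ?thesis using negligible_subset by blast
qed

section \<open>Values from within an element\<close>

text \<open>Ensures that the filter in \<open>value_in\<close> is nontrivial at every point of the
  closed element, the vertices included, so that the limit is unique.\<close>

lemma islimpt_interior_element:
  assumes "K \<in> elements M" "x \<in> K"
  shows "x islimpt interior K"
proof (cases "x \<in> interior K")
  case True
  then show ?thesis using interior_limit_point by (metis interior_interior)
next
  case False
  then show ?thesis using assms closure_interior_element by (metis UnE closure_def mem_Collect_eq)
qed

lemma value_in_eqI:
  assumes "K \<in> elements M" "x \<in> K" "continuous_on K g" "\<And>y. y \<in> interior K \<Longrightarrow> f y = g y"
  shows "value_in K f x = g x"
  unfolding value_in_def
proof (rule tendsto_Lim)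
  show "\<not> trivial_limit (at x within interior K)"
    using islimpt_interior_element assms by (simp add: trivial_limit_within)
  have "(g \<longlongrightarrow> g x) (at x within interior K)"
    using assms(2,3) interior_subset by (meson continuous_on tendsto_within_subset)
  then show "(f \<longlongrightarrow> g x) (at x within interior K)"
    by (rule Lim_transform_eventually) (auto simp: eventually_at_filter assms(4))
qed

text \<open>\<open>value_in K f\<close> is the continuous extension of \<open>f\<close> from the
  interior of \<open>K\<close> to \<open>K\<close>, and so a canonical witness for
  \<open>elementwise_continuous\<close>.\<close>

lemma continuous_on_value_in:
  assumes "elementwise_continuous M f" "K \<in> elements M"
  shows "continuous_on K (value_in K f)"
proof -
  obtain g where g: "continuous_on K g" "\<forall>x\<in>interior K. f x = g x"
    using assms unfolding elementwise_continuous_def by blast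
  then have "value_in K f x = g x" if "x \<in> K" for x
    using value_in_eqI assms that by blast
  then show ?thesis using g(1) continuous_on_cong by force
qed

lemma value_in_interior:
  assumes "elementwise_continuous M f" "K \<in> elements M" "x \<in> interior K"
  shows "value_in K f x = f x"
proof -
  obtain g where g: "continuous_on K g" "\<forall>x\<in>interior K. f x = g x"
    using assms unfolding elementwise_continuous_def by blast
  then show ?thesis
    using value_in_eqI[OF assms(2) _ g(1)] assms interior_subset by (metis subsetD)
qed

lemma value_in_cong:
  assumes "elementwise_continuous M f" "K \<in> elements M" "x \<in> K"
    "\<And>y. y \<in> interior K \<Longrightarrow> g y = f y"
  shows "value_in K g x = value_in K f x"
  using assms by (intro value_in_eqI) (auto simp: continuous_on_value_in value_in_interior)

lemma elementwise_continuous_cong: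
  assumes "elementwise_continuous M f" "\<And>K y. K \<in> elements M \<Longrightarrow> y \<in> interior K \<Longrightarrow> g y = f y"
  shows "elementwise_continuous M g"
  using assms unfolding elementwise_continuous_def by (metis (no_types, lifting))

text \<open>Stated for an arbitrary jointly continuous operation, so that sums, scalings and inner
  products are all instances.\<close>

lemma
  fixes f :: "'a \<Rightarrow> 'b :: real_normed_vector" and g :: "'a \<Rightarrow> 'c :: real_normed_vector"
    and h :: "'b \<Rightarrow> 'c \<Rightarrow> 'd :: real_normed_vector"
  assumes h: "continuous_on UNIV (\<lambda>z. h (fst z) (snd z))"
    and fg: "elementwise_continuous M f" "elementwise_continuous M g"
  shows elementwise_continuous_compose2: "elementwise_continuous M (\<lambda>x. h (f x) (g x))"
    and value_in_compose2: "K \<in> elements M \<Longrightarrow> x \<in> K \<Longrightarrow>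
      value_in K (\<lambda>x. h (f x) (g x)) x = h (value_in K f x) (value_in K g x)"
proof -
  have *: "continuous_on K (\<lambda>x. h (value_in K f x) (value_in K g x))" if K: "K \<in> elements M" for K
  proof -
    have "continuous_on K (\<lambda>x. (value_in K f x, value_in K g x))"
      by (intro continuous_on_Pair continuous_on_value_in fg K)
    from continuous_on_compose2[OF h this] show ?thesis by simp
  qed
  show "elementwise_continuous M (\<lambda>x. h (f x) (g x))"
    unfolding elementwise_continuous_def
  proof
    fix K assume K: "K \<in> elements M"
    show "\<exists>k. continuous_on K k \<and> (\<forall>x\<in>interior K. h (f x) (g x) = k x)"
      by (intro exI[of _ "\<lambda>x. h (value_in K f x) (value_in K g x)"] conjI ballI *[OF K])
        (simp add: value_in_interior[OF fg(1) K] value_in_interior[OF fg(2) K])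
  qed
  show "value_in K (\<lambda>x. h (f x) (g x)) x = h (value_in K f x) (value_in K g x)"
    if "K \<in> elements M" "x \<in> K"
    by (rule value_in_eqI[OF that *[OF that(1)]])
      (simp add: value_in_interior[OF fg(1) that(1)] value_in_interior[OF fg(2) that(1)])
qed

lemmas elementwise_continuous_add = elementwise_continuous_compose2[of "(+)"]
  and value_in_add = value_in_compose2[of "(+)"]
lemmas elementwise_continuous_scaleR = elementwise_continuous_compose2[of "(*\<^sub>R)"]
  and value_in_scaleR = value_in_compose2[of "(*\<^sub>R)"]
lemmas elementwise_continuous_inner = elementwise_continuous_compose2[of "(\<bullet>)"]

lemma elementwise_continuous_const: "elementwise_continuous M (\<lambda>_. c)"
  unfolding elementwise_continuous_def using continuous_on_const by blast

lemma value_in_const: "K \<in> elements M \<Longrightarrow> x \<in> K \<Longrightarrow> value_in K (\<lambda>_. c) x = c"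
  by (rule value_in_eqI) auto

lemma
  fixes f :: "'i \<Rightarrow> 'a \<Rightarrow> 'b :: real_normed_vector"
  assumes "finite I" "\<And>i. i \<in> I \<Longrightarrow> elementwise_continuous M (f i)"
  shows elementwise_continuous_sum: "elementwise_continuous M (\<lambda>x. \<Sum>i\<in>I. f i x)"
    and value_in_sum: "K \<in> elements M \<Longrightarrow> x \<in> K \<Longrightarrow>
      value_in K (\<lambda>x. \<Sum>i\<in>I. f i x) x = (\<Sum>i\<in>I. value_in K (f i) x)"
proof -
  have *: "elementwise_continuous M (\<lambda>x. \<Sum>i\<in>I. f i x) \<and>
      (K \<in> elements M \<longrightarrow> x \<in> K \<longrightarrow>
        value_in K (\<lambda>x. \<Sum>i\<in>I. f i x) x = (\<Sum>i\<in>I. value_in K (f i) x))"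
    using assms
  proof (induction I)
    case empty
    then show ?case by (simp add: elementwise_continuous_const value_in_const)
  next
    case (insert j I)
    then show ?case
      by (auto simp: value_in_add elementwise_continuous_add continuous_on_add
          continuous_on_fst continuous_on_snd)
  qed
  then show "elementwise_continuous M (\<lambda>x. \<Sum>i\<in>I. f i x)"
    "K \<in> elements M \<Longrightarrow> x \<in> K \<Longrightarrow>
      value_in K (\<lambda>x. \<Sum>i\<in>I. f i x) x = (\<Sum>i\<in>I. value_in K (f i) x)"
    by auto
qed

section \<open>Nodal basis functions, interpolation and masses\<close>

lemma finite_nodes: "finite (nodes M)"
  unfolding nodes_def by (intro finite_SigmaI finite_elements finite_imageI finite_ref_vertices)

lemma nodes_element: "i \<in> nodes M \<Longrightarrow> fst i \<in> elements M"
  and nodes_in: "i \<in> nodes M \<Longrightarrow> snd i \<in> fst i"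
  and refinv_node: "i \<in> nodes M \<Longrightarrow> refinv (fst i) (snd i) \<in> ref_vertices (kind M)"
  unfolding nodes_def using refmap_image refinv_refmap ref_vertices_subset by fastforce+

lemma basis_fun_eq:
  "basis_fun M i x = (if x \<in> interior (fst i) then
    ref_lagrange (kind M) (refinv (fst i) (snd i)) (refinv (fst i) x) else 0)"
  by (simp add: basis_fun_def split_beta Let_def)

lemma basis_fun_interior:
  assumes "i \<in> nodes M" "L \<in> elements M" "x \<in> interior L"
  shows "basis_fun M i x = (if L = fst i then
    ref_lagrange (kind M) (refinv (fst i) (snd i)) (refinv L x) else 0)"
  using assms disjoint_interiors[OF assms(2) nodes_element[OF assms(1)]]
  by (cases "L = fst i") (auto simp: basis_fun_eq)

text \<open>\<open>basis_fun\<close> is cut off to 0 on element boundaries. The reference polynomial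
  without the cutoff is the continuous representative through which limits at the nodes are
  computed.\<close>

lemma continuous_on_basis_fun_extension:
  assumes "i \<in> nodes M" "L \<in> elements M"
  shows "continuous_on L (\<lambda>x. if L = fst i then
    ref_lagrange (kind M) (refinv (fst i) (snd i)) (refinv L x) else 0)"
proof (cases "L = fst i")
  case True
  have "continuous_on L (\<lambda>x. ref_lagrange (kind M) (refinv (fst i) (snd i)) (refinv L x))"
    by (rule continuous_on_compose2[OF continuous_on_ref_space[OF ref_lagrange_in_ref_space]])
      (use assms refinv_node C1_refinv C1_on_imp_continuous_on in blast)+
  then show ?thesis using True by simp
qed simp

lemma elementwise_continuous_basis_fun:
  "i \<in> nodes M \<Longrightarrow> elementwise_continuous M (basis_fun M i)"
  unfolding elementwise_continuous_def
  using continuous_on_basis_fun_extension basis_fun_interior by fast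

lemma value_in_basis_fun:
  assumes "i \<in> nodes M" "j \<in> nodes M"
  shows "value_in (fst j) (basis_fun M i) (snd j) = (if i = j then 1 else 0)"
proof -
  have "value_in (fst j) (basis_fun M i) (snd j) = (if fst j = fst i then
      ref_lagrange (kind M) (refinv (fst i) (snd i)) (refinv (fst j) (snd j)) else 0)"
    by (rule value_in_eqI[OF nodes_element[OF assms(2)] nodes_in[OF assms(2)]
          continuous_on_basis_fun_extension basis_fun_interior])
      (use assms nodes_element in auto)
  also have "\<dots> = (if i = j then 1 else 0)"
  proof (cases "fst j = fst i")
    case True
    \<comment> \<open>Within one element, applying \<open>refmap\<close> recovers a node from its
      reference vertex, so distinct nodes have distinct reference vertices.\<close>
    have "refinv (fst j) (snd j) = refinv (fst i) (snd i) \<longleftrightarrow> i = j"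
      using refmap_refinv[OF nodes_element nodes_in] assms True by (metis prod_eqI)
    then show ?thesis
      using True ref_lagrange_vertex[OF refinv_node[OF assms(1)] refinv_node[OF assms(2)]] by auto
  qed auto
  finally show ?thesis .
qed

lemma elementwise_continuous_fe_fun: "elementwise_continuous M (fe_fun M c)"
  for c :: "'a node \<Rightarrow> 'b::real_normed_vector"
proof -
  have "elementwise_continuous M (\<lambda>x. \<Sum>i\<in>nodes M. basis_fun M i x *\<^sub>R c i)"
    by (intro elementwise_continuous_sum elementwise_continuous_scaleR continuous_intros
        elementwise_continuous_basis_fun elementwise_continuous_const finite_nodes)
  then show ?thesis by (simp add: fe_fun_def[abs_def])
qed

lemma value_in_fe_fun:
  fixes c :: "'a node \<Rightarrow> 'b::real_normed_vector"
  assumes j: "j \<in> nodes M"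
  shows "value_in (fst j) (fe_fun M c) (snd j) = c j"
proof -
  have "value_in (fst j) (fe_fun M c) (snd j) =
      (\<Sum>i\<in>nodes M. value_in (fst j) (\<lambda>x. basis_fun M i x *\<^sub>R c i) (snd j))"
    unfolding fe_fun_def[abs_def]
    by (intro value_in_sum elementwise_continuous_scaleR continuous_intros finite_nodes
        elementwise_continuous_basis_fun elementwise_continuous_const nodes_element nodes_in j)
  also have "\<dots> = (\<Sum>i\<in>nodes M. (if i = j then 1 else 0) *\<^sub>R c i)"
  proof (rule sum.cong)
    fix i assume i: "i \<in> nodes M"
    have "value_in (fst j) (\<lambda>x. basis_fun M i x *\<^sub>R c i) (snd j) =
        value_in (fst j) (basis_fun M i) (snd j) *\<^sub>R value_in (fst j) (\<lambda>_. c i) (snd j)"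
      by (intro value_in_scaleR continuous_intros elementwise_continuous_basis_fun
          elementwise_continuous_const nodes_element nodes_in i j)
    then show "value_in (fst j) (\<lambda>x. basis_fun M i x *\<^sub>R c i) (snd j) = (if i = j then 1 else 0) *\<^sub>R c i"
      using i j by (simp add: value_in_basis_fun value_in_const nodes_element nodes_in)
  qed simp
  also have "\<dots> = (\<Sum>i\<in>nodes M. if i = j then c i else 0)"
    by (rule sum.cong) auto
  also have "\<dots> = c j"
    using j finite_nodes by simp
  finally show ?thesis .
qed

lemma basis_fun_nonneg: "i \<in> nodes M \<Longrightarrow> 0 \<le> basis_fun M i x"
  using ref_lagrange_nonneg[OF refinv_node[of i] refinv_in_ref[OF nodes_element[of i]]]
    interior_subset[of "fst i"]
  by (auto simp: basis_fun_eq)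

text \<open>Needed for the sign of the kinetic energy of a patch.\<close>

lemma mass_nonneg: "i \<in> nodes M \<Longrightarrow> 0 \<le> mass M i"
  unfolding mass_def set_lebesgue_integral_def
  by (intro integral_nonneg_AE) (simp add: basis_fun_nonneg)

text \<open>\<open>mass\<close> integrates over the whole region, but a basis function lives in the
  interior of its own element, so that element contributes all of the mass.\<close>

lemma lint_basis_fun:
  assumes i: "i \<in> nodes M" and L: "L \<in> elements M"
  shows "(LINT x:interior L|lebesgue. basis_fun M i x) = (if L = fst i then mass M i else 0)"
proof (cases "L = fst i")
  case True
  have "(\<lambda>x. indicator (interior L) x *\<^sub>R basis_fun M i x) =
      (\<lambda>x. indicator (region M) x *\<^sub>R basis_fun M i x)"
    using interior_subset_region[OF L] True
    by (auto simp: basis_fun_eq fun_eq_iff split: split_indicator)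
  then show ?thesis using True unfolding mass_def set_lebesgue_integral_def by metis
next
  case False
  have "indicator (interior L) x *\<^sub>R basis_fun M i x = 0" for x
    using basis_fun_interior[OF i L] False by (auto split: split_indicator)
  then show ?thesis using False unfolding set_lebesgue_integral_def by (simp del: scaleR_eq_0_iff real_scaleR_def)
qed

section \<open>Gradients of elementwise mapped polynomials\<close>

lemma broken_space_refinv:
  assumes "f \<in> broken_space M" "K \<in> elements M"
  obtains p where "p \<in> ref_space (kind M)" "\<And>x. x \<in> interior K \<Longrightarrow> f x = p (refinv K x)"
proof -
  obtain p where p: "p \<in> ref_space (kind M)" "\<And>y. y \<in> interior ref \<Longrightarrow> f (refmap M K y) = p y"
    using assms unfolding broken_space_def by blast
  have "f x = p (refinv K x)" if "x \<in> interior K" for x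
    using p(2)[OF refinv_interior[OF assms(2) that]] refmap_refinv[OF assms(2)] that interior_subset
    by fastforce
  with p(1) that show thesis by blast
qed

lemma GDERIV_broken_space:
  assumes f: "f \<in> broken_space M" and K: "K \<in> elements M"
  obtains g where "continuous_on K g" "\<And>x. x \<in> interior K \<Longrightarrow> GDERIV f x :> g x"
proof -
  obtain p where p: "p \<in> ref_space (kind M)" "\<And>x. x \<in> interior K \<Longrightarrow> f x = p (refinv K x)"
    using broken_space_refinv[OF f K] by blast
  obtain q where q: "continuous_on UNIV q" "\<And>x. GDERIV p x :> q x"
    using ref_space_gradient[OF p(1)] by blast
  obtain R' :: "'a \<Rightarrow> 'a \<Rightarrow>\<^sub>L 'a" where R': "continuous_on K R'"
    "\<And>x. x \<in> K \<Longrightarrow> (refinv K has_derivative blinfun_apply (R' x)) (at x within K)"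
    using C1_refinv[OF K] unfolding C1_on_def by blast
  \<comment> \<open>By the chain rule the gradient is the adjoint of \<open>R' x\<close> applied to
    the reference gradient. Written in coordinates, its continuity up to the boundary of
    \<open>K\<close> follows from that of \<open>R'\<close> and \<open>q\<close>.\<close>
  define g where "g x = (\<Sum>b\<in>Basis. (blinfun_apply (R' x) b \<bullet> q (refinv K x)) *\<^sub>R b)" for x
  have "continuous_on K (\<lambda>x. q (refinv K x))"
    by (rule continuous_on_compose2[OF q(1) C1_on_imp_continuous_on[OF C1_refinv[OF K]]]) auto
  then have "continuous_on K g"
    unfolding g_def by (intro continuous_intros R')
  moreover have "GDERIV f x :> g x" if x: "x \<in> interior K" for x
  proof -
    have "x \<in> K" using x interior_subset by blast
    then have "(refinv K has_derivative blinfun_apply (R' x)) (at x)"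
      using R'(2) x by (metis at_within_interior)
    moreover have "(p has_derivative (\<lambda>h. h \<bullet> q (refinv K x))) (at (refinv K x))"
      using q(2) unfolding gderiv_def by blast
    ultimately have "((\<lambda>x. p (refinv K x)) has_derivative
        (\<lambda>h. blinfun_apply (R' x) h \<bullet> q (refinv K x))) (at x)"
      by (rule has_derivative_compose)
    then have "(f has_derivative (\<lambda>h. blinfun_apply (R' x) h \<bullet> q (refinv K x))) (at x)"
      by (rule has_derivative_transform_within_open[OF _ open_interior x]) (simp add: p(2))
    moreover have "blinfun_apply (R' x) h \<bullet> q (refinv K x) = h \<bullet> g x" for h
    proof -
      have "blinfun_apply (R' x) h = (\<Sum>b\<in>Basis. (h \<bullet> b) *\<^sub>R blinfun_apply (R' x) b)"
        by (subst (1) euclidean_representation[of h, symmetric]) 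
          (simp only: blinfun.sum_right blinfun.scaleR_right)
      then show ?thesis by (simp add: g_def inner_sum_left inner_sum_right mult.commute)
    qed
    ultimately show ?thesis unfolding gderiv_def by simp
  qed
  ultimately show thesis using that by blast
qed

lemma elementwise_continuous_grad:
  "f \<in> broken_space M \<Longrightarrow> elementwise_continuous M (grad f)"
  unfolding elementwise_continuous_def by (metis GDERIV_broken_space grad_eqI)

lemma grad_add_interior:
  assumes "f \<in> broken_space M" "g \<in> broken_space M" "K \<in> elements M" "x \<in> interior K"
  shows "grad (\<lambda>x. f x + g x) x = grad f x + grad g x"
  by (metis GDERIV_add GDERIV_broken_space assms grad_eqI)

text \<open>\<open>refmap\<close> is affine and injective only on the reference simplex. Since the
  simplex has interior points, injectivity there already forces the linear part to be injective on
  the whole space.\<close>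

lemma simplex_refmap_inverse:
  assumes S: "kind M = Simplicial" and K: "K \<in> elements M"
  obtains A b where "linear A" "\<And>x. x \<in> K \<Longrightarrow> refinv K x = A (x - b)"
proof -
  obtain A b where A: "linear A" "\<And>x. x \<in> ref \<Longrightarrow> refmap M K x = A x + b"
    using refmap_affine[OF S K] by blast
  have "x = 0" if "A x = 0" for x
  proof (rule ccontr)
    assume "x \<noteq> 0"
    obtain y e where e: "e > 0" "cball y e \<subseteq> ref"
      using interior_ref_elem_nonempty by (metis all_not_in_conv mem_interior_cball)
    \<comment> \<open>A kernel vector rescaled to length \<open>e\<close> moves \<open>y\<close> to
      another point of the reference element with the same image.\<close>
    define z where "z = y + (e / norm x) *\<^sub>R x"
    have "z \<in> cball y e" "y \<in> cball y e" using e \<open>x \<noteq> 0\<close> by (auto simp: z_def dist_norm)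
    moreover have "A z = A y" using A(1) that by (simp add: z_def linear_add linear_scale)
    ultimately have "z = y" using inj_refmap[OF K] A(2) e(2) by (metis inj_onD subsetD)
    then show False using e \<open>x \<noteq> 0\<close> by (simp add: z_def)
  qed
  then have "inj A" using A(1) by (simp add: linear_injective_0)
  then obtain A' where A': "linear A'" "A' \<circ> A = id"
    using A(1) linear_injective_left_inverse by blast
  have "refinv K x = A' (x - b)" if "x \<in> K" for x
  proof -
    have "x - b = A (refinv K x)"
      using A(2)[OF refinv_in_ref[OF K that]] refmap_refinv[OF K that] by (simp add: algebra_simps)
    then show ?thesis using A'(2) by (metis comp_apply id_apply)
  qed
  with A'(1) that show thesis by blast
qed

lemma simplex_grad_const:
  assumes S: "kind M = Simplicial" and f: "f \<in> broken_space M" and K: "K \<in> elements M"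
  obtains g where "\<And>x. x \<in> interior K \<Longrightarrow> grad f x = g"
proof -
  obtain p where p: "p \<in> ref_space (kind M)" "\<And>x. x \<in> interior K \<Longrightarrow> f x = p (refinv K x)"
    using broken_space_refinv[OF f K] by blast
  then obtain c a where ca: "\<And>x. p x = c + a \<bullet> x" using S by auto
  obtain A b where A: "linear A" "\<And>x. x \<in> K \<Longrightarrow> refinv K x = A (x - b)"
    using simplex_refmap_inverse[OF S K] by blast
  have "grad f x = adjoint A a" if x: "x \<in> interior K" for x
  proof (rule grad_eqI)
    have "((\<lambda>x. c + a \<bullet> A (x - b)) has_derivative (\<lambda>h. a \<bullet> A h)) (at x)"
      by (auto intro!: derivative_eq_intros has_derivative_compose[of "\<lambda>x. x - b" "\<lambda>h. h" _ _ A]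
          linear_imp_has_derivative A(1))
    then have "(f has_derivative (\<lambda>h. a \<bullet> A h)) (at x)"
      by (rule has_derivative_transform_within_open[OF _ open_interior x])
        (use p(2) ca A(2) interior_subset[of K] in \<open>auto simp: subset_eq\<close>)
    then show "GDERIV f x :> adjoint A a"
      unfolding gderiv_def using adjoint_works[OF A(1)] by (simp add: inner_commute)
  qed
  with that show thesis by blast
qed

section \<open>Integrals over unions of elements\<close>

text \<open>The continuous extension of \<open>f\<close> is integrable over the compact element, and
  it agrees with \<open>f\<close> on the interior.\<close>

lemma integrable_interior_element:
  fixes f :: "'a \<Rightarrow> real"
  assumes f: "elementwise_continuous M f" and K: "K \<in> elements M"
  shows "set_integrable lebesgue (interior K) f"
proof -
  have "integrable lborel (\<lambda>x. indicator K x *\<^sub>R value_in K f x)"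
    by (rule borel_integrable_compact[OF compact_element[OF K] continuous_on_value_in[OF f K]])
  then have "set_integrable lebesgue K (value_in K f)"
    unfolding set_integrable_def by (subst integrable_completion) auto
  then have "set_integrable lebesgue (interior K) (value_in K f)"
    by (rule set_integrable_subset) (auto simp: interior_subset)
  then show ?thesis
    using set_integrable_cong[OF refl refl, of "interior K" "value_in K f" f lebesgue]
      value_in_interior[OF f K] by blast
qed

text \<open>The set \<open>X\<close> is only squeezed between the open and the closed unions, so
  that the same statement serves the open region and the closed patches. The gap consists of element
  boundaries.\<close>

lemma
  fixes f :: "'a \<Rightarrow> real"
  assumes f: "elementwise_continuous M f" and S: "S \<subseteq> elements M"
    and X: "(\<Union>K\<in>S. interior K) \<subseteq> X" "X \<subseteq> \<Union> S"
  shows integrable_union_elements: "set_integrable lebesgue X f"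
    and lint_union_elements:
      "(LINT x:X|lebesgue. f x) = (\<Sum>K\<in>S. LINT x:interior K|lebesgue. f x)"
proof -
  let ?Y = "\<Union>K\<in>S. interior K"
  have fin: "finite S" using S finite_elements finite_subset by blast
  have Y: "set_integrable lebesgue ?Y f"
    using fin S by (intro set_integrable_UN integrable_interior_element f) auto
  have "X - ?Y \<subseteq> (\<Union>K\<in>S. frontier K)"
    using X(2) unfolding frontier_def by (clarsimp simp: subset_eq) (metis closure_subset subsetD)
  moreover have "negligible (\<Union>K\<in>S. frontier K)"
    using fin S negligible_frontier_element by (intro negligible_Union) auto
  ultimately have "negligible (X - ?Y)" using negligible_subset by blast
  then have neg: "negligible {x \<in> X - ?Y. f x \<noteq> 0}" "negligible {x \<in> ?Y - X. f x \<noteq> 0}"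
    using X(1) by (auto intro: negligible_subset)
  show X_int: "set_integrable lebesgue X f"
    by (rule absolutely_integrable_spike_set[OF Y neg(2,1)])
  have "(LINT x:X|lebesgue. f x) = (LINT x:?Y|lebesgue. f x)"
    using set_lebesgue_integral_eq_integral(2)[OF X_int] set_lebesgue_integral_eq_integral(2)[OF Y]
      integral_spike_set[OF neg] by simp
  also have "\<dots> = (\<Sum>K\<in>S. LINT x:interior K|lebesgue. f x)"
    using fin S disjoint_interiors
    by (intro set_integral_finite_Union integrable_interior_element f)
      (auto simp: disjoint_family_on_def)
  finally show "(LINT x:X|lebesgue. f x) = (\<Sum>K\<in>S. LINT x:interior K|lebesgue. f x)" .
qed

lemma region_between_elements:
  "(\<Union>K\<in>elements M. interior K) \<subseteq> region M" "region M \<subseteq> \<Union> (elements M)"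
  using interior_subset_region closure_subset by (auto simp: Union_elements)

lemma
  fixes f g :: "'a \<Rightarrow> 'b :: euclidean_space"
  assumes fg: "elementwise_continuous M f" "elementwise_continuous M g"
  shows l2_inner_elements: "l2_inner (region M) f g =
      (\<Sum>K\<in>elements M. LINT x:interior K|lebesgue. f x \<bullet> g x)"
    and integrable_inner_region: "set_integrable lebesgue (region M) (\<lambda>x. f x \<bullet> g x)"
proof -
  have "elementwise_continuous M (\<lambda>x. f x \<bullet> g x)"
    by (intro elementwise_continuous_inner continuous_intros fg)
  then show "l2_inner (region M) f g =
      (\<Sum>K\<in>elements M. LINT x:interior K|lebesgue. f x \<bullet> g x)"
    "set_integrable lebesgue (region M) (\<lambda>x. f x \<bullet> g x)"
    unfolding l2_inner_def
    using lint_union_elements integrable_union_elements region_between_elements by blast+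
qed

text \<open>Agreement inside the elements suffices; this is how the gradient of a sum of potentials
  is replaced by the sum of their gradients.\<close>

lemma l2_inner_cong:
  fixes f g :: "'a \<Rightarrow> 'b :: euclidean_space"
  assumes "elementwise_continuous M f" "elementwise_continuous M g"
    and "\<And>K x. K \<in> elements M \<Longrightarrow> x \<in> interior K \<Longrightarrow> g' x = g x"
  shows "l2_inner (region M) f g' = l2_inner (region M) f g"
proof -
  have "elementwise_continuous M g'"
    using elementwise_continuous_cong[OF assms(2)] assms(3) by blast
  then show ?thesis
    using assms by (auto simp: l2_inner_elements intro!: sum.cong set_lebesgue_integral_cong)
qed

lemma l2_inner_add_right:
  fixes f g h :: "'a \<Rightarrow> 'b :: euclidean_space"
  assumes "elementwise_continuous M f" "elementwise_continuous M g" "elementwise_continuous M h"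
  shows "l2_inner (region M) f (\<lambda>x. g x + h x) = l2_inner (region M) f g + l2_inner (region M) f h"
  unfolding l2_inner_def inner_add_right
  by (intro set_integral_add integrable_inner_region assms)

lemma l2_inner_commute: "l2_inner S f g = l2_inner S g f"
  unfolding l2_inner_def by (simp add: inner_commute)

text \<open>Vertex quadrature is exact on finite element functions, because its weights are the
  integrals of the nodal basis.\<close>

lemma lint_fe_fun:
  fixes c :: "'a node \<Rightarrow> real"
  assumes K: "K \<in> elements M"
  shows "(LINT x:interior K|lebesgue. fe_fun M c x) =
    (\<Sum>i\<in>nodes M. if K = fst i then mass M i * c i else 0)"
proof -
  have "(LINT x:interior K|lebesgue. fe_fun M c x) =
      (LINT x|lebesgue. (\<Sum>i\<in>nodes M. indicator (interior K) x *\<^sub>R (basis_fun M i x * c i)))"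
    by (simp add: set_lebesgue_integral_def fe_fun_def sum_distrib_left)
  also have "\<dots> = (\<Sum>i\<in>nodes M. LINT x:interior K|lebesgue. basis_fun M i x * c i)"
    using integrable_interior_element[OF elementwise_continuous_basis_fun K]
    unfolding set_lebesgue_integral_def
    by (intro Bochner_Integration.integral_sum) (simp add: set_integrable_def mult.assoc[symmetric])
  also have "\<dots> = (\<Sum>i\<in>nodes M. if K = fst i then mass M i * c i else 0)"
    by (intro sum.cong) (auto simp: lint_basis_fun K)
  finally show ?thesis .
qed

text \<open>On each element the integrand is the density times the constant
  \<open>u K \<bullet> v K\<close>, and the quadrature is exact for such functions.\<close>

lemma l2_inner_eq_lumped_simplicial:
  assumes S: "kind M = Simplicial" and fg: "f \<in> broken_space M" "g \<in> broken_space M"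
  shows "l2_inner (region M) (\<lambda>x. fe_fun M \<rho> x *\<^sub>R grad f x) (grad g) =
    lumped M (\<lambda>x. fe_fun M \<rho> x *\<^sub>R grad f x) (grad g)"
proof -
  let ?F = "\<lambda>x. fe_fun M \<rho> x *\<^sub>R grad f x"
  have ec: "elementwise_continuous M ?F" "elementwise_continuous M (grad g)"
    using fg by (auto intro!: elementwise_continuous_scaleR continuous_intros
        elementwise_continuous_fe_fun elementwise_continuous_grad)
  have "\<exists>u v. \<forall>x\<in>interior K. grad f x = u \<and> grad g x = v" if "K \<in> elements M" for K
    using simplex_grad_const[OF S fg(1) that] simplex_grad_const[OF S fg(2) that] by metis
  then obtain u v where
    uv: "\<And>K x. K \<in> elements M \<Longrightarrow> x \<in> interior K \<Longrightarrow> grad f x = u K \<and> grad g x = v K"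
    by metis
  have val: "value_in K (grad f) x = u K" "value_in K (grad g) x = v K"
    if "K \<in> elements M" "x \<in> K" for K x
    by (rule value_in_eqI[OF that], use uv that in auto)+
  have "l2_inner (region M) ?F (grad g) =
      (\<Sum>K\<in>elements M. LINT x:interior K|lebesgue. ?F x \<bullet> grad g x)"
    by (rule l2_inner_elements[OF ec])
  also have "\<dots> = (\<Sum>K\<in>elements M. LINT x:interior K|lebesgue. fe_fun M \<rho> x * (u K \<bullet> v K))"
    using uv by (intro sum.cong set_lebesgue_integral_cong) auto
  also have "\<dots> = (\<Sum>K\<in>elements M. \<Sum>i\<in>nodes M.
      if K = fst i then mass M i * \<rho> i * (u (fst i) \<bullet> v (fst i)) else 0)"
    by (intro sum.cong refl) (simp add: lint_fe_fun sum_distrib_right, auto intro!: sum.cong)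
  \<comment> \<open>Every node belongs to exactly one element, so after the swap the inner sum has a
    single nonzero candidate.\<close>
  also have "\<dots> = (\<Sum>i\<in>nodes M. \<Sum>K\<in>elements M.
      if K = fst i then mass M i * \<rho> i * (u (fst i) \<bullet> v (fst i)) else 0)"
    by (rule sum.swap)
  also have "\<dots> = (\<Sum>i\<in>nodes M. mass M i * \<rho> i * (u (fst i) \<bullet> v (fst i)))"
    by (intro sum.cong) (auto simp: finite_elements nodes_element)
  also have "\<dots> = lumped M ?F (grad g)"
    unfolding lumped_def
    by (intro sum.cong) (auto simp: value_in_scaleR continuous_intros elementwise_continuous_fe_fun
        elementwise_continuous_grad fg nodes_element nodes_in val value_in_fe_fun)
  finally show ?thesis .
qed

text \<open>The two settings merge here: from now on the density term is a nodal sum in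
  both.\<close>

lemma a_form_lumped:
  assumes "f \<in> broken_space M" "g \<in> broken_space M"
  shows "a_form M \<alpha> \<tau> \<sigma> \<rho> f g = l2_inner (region M) (grad f) (grad g) +
    \<sigma> * (\<tau>\<^sup>2 * \<alpha> / 4) * (\<Sum>i\<in>nodes M. mass M i * \<rho> i *
      (value_in (fst i) (grad f) (snd i) \<bullet> value_in (fst i) (grad g) (snd i)))"
proof -
  have "a_form M \<alpha> \<tau> \<sigma> \<rho> f g = l2_inner (region M) (grad f) (grad g) +
    \<sigma> * (\<tau>\<^sup>2 * \<alpha> / 4) * lumped M (\<lambda>x. fe_fun M \<rho> x *\<^sub>R grad f x) (grad g)"
    unfolding a_form_def
    by (cases "kind M") (simp_all add: l2_inner_eq_lumped_simplicial assms)
  also have "lumped M (\<lambda>x. fe_fun M \<rho> x *\<^sub>R grad f x) (grad g) =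
    (\<Sum>i\<in>nodes M. mass M i * \<rho> i *
      (value_in (fst i) (grad f) (snd i) \<bullet> value_in (fst i) (grad g) (snd i)))"
    unfolding lumped_def
    by (intro sum.cong) (auto simp: value_in_scaleR continuous_intros elementwise_continuous_fe_fun
        elementwise_continuous_grad assms nodes_element nodes_in value_in_fe_fun)
  finally show ?thesis .
qed

section \<open>Energy balance of the source update\<close>

lemma source_update_energy:
  assumes src: "source_update M bc \<alpha> \<tau> U \<phi> U' \<phi>'" and "\<alpha> \<noteq> 0"
    and dens: "\<And>i. i \<in> nodes M \<Longrightarrow> dens U i > 0" and \<phi>: "\<phi> \<in> potential_space M bc"
  shows "(\<Sum>i\<in>nodes M. mass M i * ener U' i) + 1 / (2 * \<alpha>) * (l2_norm (region M) (grad \<phi>'))\<^sup>2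
       = (\<Sum>i\<in>nodes M. mass M i * ener U i) + 1 / (2 * \<alpha>) * (l2_norm (region M) (grad \<phi>))\<^sup>2"
proof -
  define V where "V = (\<lambda>i. mom U i /\<^sub>R dens U i)"
  define \<omega> where "\<omega> = (\<lambda>x. \<phi>' x + \<phi> x)"
  define p where "p i = value_in (fst i) (grad \<phi>') (snd i)" for i
  define q where "q i = value_in (fst i) (grad \<phi>) (snd i)" for i
  define G where "G i = p i + q i" for i
  define c where "c i = mass M i * dens U i" for i
  let ?I = "\<lambda>f g. l2_inner (region M) (grad f) (grad g)"
  have \<phi>': "\<phi>' \<in> potential_space M bc"
    and eq: "\<And>\<omega>. \<omega> \<in> potential_space M bc \<Longrightarrow> a_form M \<alpha> \<tau> 1 (dens U) \<phi>' \<omega> =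
       a_form M \<alpha> \<tau> (-1) (dens U) \<phi> \<omega>
       + \<tau> * \<alpha> * lumped M (\<lambda>x. fe_fun M (dens U) x *\<^sub>R fe_fun M V x) (grad \<omega>)"
    and upd: "\<And>i. i \<in> nodes M \<Longrightarrow> dens U' i = dens U i \<and>
       mom U' i = dens U i *\<^sub>R
         (V i - (\<tau> / 2) *\<^sub>R value_in (fst i) (\<lambda>x. grad \<phi>' x + grad \<phi> x) (snd i)) \<and>
       ener U' i = ener U i +
         1 / (2 * dens U' i) * ((norm (mom U' i))\<^sup>2 - (norm (mom U i))\<^sup>2)"
    using src unfolding source_update_def Let_def V_def by blast+
  have \<omega>: "\<omega> \<in> potential_space M bc"
    unfolding \<omega>_def by (rule potential_space_add[OF \<phi>' \<phi>])
  have br: "\<phi> \<in> broken_space M" "\<phi>' \<in> broken_space M" "\<omega> \<in> broken_space M"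
    using \<phi> \<phi>' \<omega> potential_space_subset by blast+
  note ec = elementwise_continuous_grad[OF br(1)] elementwise_continuous_grad[OF br(2)]
    elementwise_continuous_grad[OF br(3)]
  have sum_ec: "elementwise_continuous M (\<lambda>x. grad \<phi>' x + grad \<phi> x)"
    by (intro elementwise_continuous_add continuous_intros ec)
  have grad_\<omega>: "grad \<omega> x = grad \<phi>' x + grad \<phi> x" if "K \<in> elements M" "x \<in> interior K" for K x
    unfolding \<omega>_def by (rule grad_add_interior[OF br(2,1) that])
  have val_sum: "value_in (fst i) (\<lambda>x. grad \<phi>' x + grad \<phi> x) (snd i) = G i" if "i \<in> nodes M" for i
    unfolding G_def p_def q_def
    by (intro value_in_add continuous_intros ec nodes_element nodes_in that)
  have val_\<omega>: "value_in (fst i) (grad \<omega>) (snd i) = G i" if "i \<in> nodes M" for i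
    using value_in_cong[OF sum_ec nodes_element[OF that] nodes_in[OF that], of "grad \<omega>"] grad_\<omega>
      nodes_element[OF that] val_sum[OF that] by simp
  have I_\<omega>: "?I f \<omega> = ?I f \<phi>' + ?I f \<phi>" if f: "f \<in> broken_space M" for f
    using l2_inner_cong[OF elementwise_continuous_grad[OF f] sum_ec, of "grad \<omega>"] grad_\<omega>
      l2_inner_add_right[OF elementwise_continuous_grad[OF f] ec(2,1)] by simp
  have a: "a_form M \<alpha> \<tau> \<sigma> (dens U) f \<omega> = ?I f \<omega> + \<sigma> * (\<tau>\<^sup>2 * \<alpha> / 4) *
      (\<Sum>i\<in>nodes M. c i * (value_in (fst i) (grad f) (snd i) \<bullet> G i))" if "f \<in> broken_space M" for f \<sigma>
    using that br(3) by (simp add: a_form_lumped val_\<omega> c_def)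
  have l: "lumped M (\<lambda>x. fe_fun M (dens U) x *\<^sub>R fe_fun M V x) (grad \<omega>) =
      (\<Sum>i\<in>nodes M. c i * (V i \<bullet> G i))"
    unfolding lumped_def
  proof (intro sum.cong refl)
    fix i assume i: "i \<in> nodes M"
    have "value_in (fst i) (\<lambda>x. fe_fun M (dens U) x *\<^sub>R fe_fun M V x) (snd i) = dens U i *\<^sub>R V i"
      by (subst value_in_scaleR) (auto intro!: continuous_intros elementwise_continuous_fe_fun
          simp: nodes_element nodes_in value_in_fe_fun i)
    then show "mass M i * (value_in (fst i) (\<lambda>x. fe_fun M (dens U) x *\<^sub>R fe_fun M V x) (snd i)
        \<bullet> value_in (fst i) (grad \<omega>) (snd i)) = c i * (V i \<bullet> G i)"
      by (simp add: val_\<omega> i c_def)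
  qed
  \<comment> \<open>The mixed products of the two gradients stand on both sides of the tested
    equation and cancel by symmetry. The \<open>p\<close> and \<open>q\<close> terms end up with the
    same sign because the two forms carry opposite signs.\<close>
  have "?I \<phi>' \<phi>' - ?I \<phi> \<phi> = \<tau> * \<alpha> * (\<Sum>i\<in>nodes M. c i * (V i \<bullet> G i)) - \<tau>\<^sup>2 * \<alpha> / 4 *
      ((\<Sum>i\<in>nodes M. c i * (p i \<bullet> G i)) + (\<Sum>i\<in>nodes M. c i * (q i \<bullet> G i)))"
    using eq[OF \<omega>] l2_inner_commute[of "region M" "grad \<phi>'" "grad \<phi>"]
    unfolding a[OF br(1)] a[OF br(2)] l I_\<omega>[OF br(1)] I_\<omega>[OF br(2)] p_def[symmetric] q_def[symmetric]
    by (simp add: algebra_simps)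
  also have "(\<Sum>i\<in>nodes M. c i * (p i \<bullet> G i)) + (\<Sum>i\<in>nodes M. c i * (q i \<bullet> G i)) =
      (\<Sum>i\<in>nodes M. c i * (G i \<bullet> G i))"
    unfolding sum.distrib[symmetric] by (simp add: G_def inner_add_left distrib_left)
  finally have field: "1 / (2 * \<alpha>) * (?I \<phi>' \<phi>' - ?I \<phi> \<phi>) =
      \<tau> / 2 * (\<Sum>i\<in>nodes M. c i * (V i \<bullet> G i)) - \<tau>\<^sup>2 / 8 * (\<Sum>i\<in>nodes M. c i * (G i \<bullet> G i))"
    using \<open>\<alpha> \<noteq> 0\<close> by (simp add: field_simps)
  \<comment> \<open>Nodewise expansion of the kinetic energy at
    \<open>V i - (\<tau> / 2) *\<^sub>R G i\<close>: the cross term and the square carry the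
    coefficients of \<open>field\<close> with opposite signs, so the sums cancel.\<close>
  have "mass M i * ener U' i = mass M i * ener U i
      - \<tau> / 2 * (c i * (V i \<bullet> G i)) + \<tau>\<^sup>2 / 8 * (c i * (G i \<bullet> G i))" if i: "i \<in> nodes M" for i
  proof -
    have U: "mom U i = dens U i *\<^sub>R V i" using dens[OF i] by (simp add: V_def)
    have U': "mom U' i = dens U i *\<^sub>R (V i - (\<tau> / 2) *\<^sub>R G i)" "dens U' i = dens U i"
      using upd[OF i] val_sum[OF i] by auto
    have "1 / (2 * dens U i) * ((norm (mom U' i))\<^sup>2 - (norm (mom U i))\<^sup>2) =
        dens U i / 2 * ((norm (V i - (\<tau> / 2) *\<^sub>R G i))\<^sup>2 - (norm (V i))\<^sup>2)"
      using dens[OF i] unfolding U U' norm_scaleR power_mult_distrib power2_abs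
      by (simp add: power2_eq_square field_simps del: scaleR_right_diff_distrib)
    also have "(norm (V i - (\<tau> / 2) *\<^sub>R G i))\<^sup>2 - (norm (V i))\<^sup>2 = - \<tau> * (V i \<bullet> G i) + \<tau>\<^sup>2 / 4 * (G i \<bullet> G i)"
      unfolding power2_norm_eq_inner
      by (simp add: inner_diff_left inner_diff_right inner_commute power2_eq_square field_simps)
    finally have "ener U' i = ener U i + dens U i / 2 * (- \<tau> * (V i \<bullet> G i) + \<tau>\<^sup>2 / 4 * (G i \<bullet> G i))"
      using upd[OF i] unfolding U'(2) by metis
    then show ?thesis unfolding c_def by (simp only:) (simp add: algebra_simps)
  qed
  then have "(\<Sum>i\<in>nodes M. mass M i * ener U' i) = (\<Sum>i\<in>nodes M. mass M i * ener U i)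
      - \<tau> / 2 * (\<Sum>i\<in>nodes M. c i * (V i \<bullet> G i)) + \<tau>\<^sup>2 / 8 * (\<Sum>i\<in>nodes M. c i * (G i \<bullet> G i))"
    by (simp add: sum.distrib sum_subtractf sum_distrib_left)
  then show ?thesis
    using field by (simp add: l2_norm_power2 right_diff_distrib)
qed

section \<open>Patches\<close>

text \<open>An open set that misses the interior of \<open>L\<close> also misses its closure, which
  is all of \<open>L\<close>. So an interior point identifies its element even among closed
  elements.\<close>

lemma element_eqI:
  assumes "K \<in> elements M" "L \<in> elements M" "x \<in> interior K" "x \<in> L"
  shows "K = L"
proof (rule ccontr)
  assume "K \<noteq> L"
  then have "interior K \<inter> closure (interior L) = {}"
    using disjoint_interiors[OF assms(1,2)] by (simp add: open_Int_closure_eq_empty)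
  then show False using assms closure_interior_element by blast
qed

text \<open>Replaces the unspecified family in \<open>patch_partition\<close> by the largest one,
  which matches the selection made in \<open>patch_nodes\<close>.\<close>

lemma patch_union:
  assumes "patch_partition M \<P>" "P \<in> \<P>"
  shows "P = \<Union> {K \<in> elements M. K \<subseteq> P}"
proof -
  obtain S where "S \<subseteq> elements M" "P = \<Union> S"
    using assms unfolding patch_partition_def by metis
  then show ?thesis by blast
qed

lemma finite_patches:
  assumes "patch_partition M \<P>"
  shows "finite \<P>"
proof (rule finite_subset)
  show "\<P> \<subseteq> Union ` Pow (elements M)" using patch_union[OF assms] by (auto simp: image_iff Bex_def Pow_iff)
qed (simp add: finite_elements)

text \<open>Patches may share boundary points, so an interior point \<open>x\<close> of
  \<open>K\<close> is followed instead. Some patch contains \<open>x\<close>, an element of that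
  patch containing \<open>x\<close> must be \<open>K\<close>, and two such patches would have
  overlapping interiors.\<close>

lemma element_in_unique_patch:
  assumes \<P>: "patch_partition M \<P>" and K: "K \<in> elements M"
  shows "\<exists>!P. P \<in> \<P> \<and> K \<subseteq> P"
proof -
  obtain x where x: "x \<in> interior K" using interior_element_nonempty[OF K] by blast
  have "\<Union> \<P> = closure (region M)" using \<P> unfolding patch_partition_def by blast
  then have "x \<in> \<Union> \<P>" using x K interior_subset Union_elements by blast
  then obtain P where P: "P \<in> \<P>" "x \<in> P" by blast
  then obtain L where "L \<in> elements M" "L \<subseteq> P" "x \<in> L" using patch_union[OF \<P> P(1)] by blast
  then have "K \<subseteq> P" using element_eqI[OF K _ x] by blast
  moreover have "Q = P" if "Q \<in> \<P>" "K \<subseteq> Q" for Q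
  proof (rule ccontr)
    assume "Q \<noteq> P"
    then have "interior Q \<inter> interior P = {}" using \<P> that P unfolding patch_partition_def by blast
    then show False using x interior_mono[OF that(2)] interior_mono[OF \<open>K \<subseteq> P\<close>] by blast
  qed
  ultimately show ?thesis using P(1) by blast
qed

text \<open>The map \<open>k\<close> assigns an element to each index: the identity when summing
  over elements, \<open>fst\<close> when summing over nodes.\<close>

lemma sum_patches:
  fixes f :: "'i \<Rightarrow> real"
  assumes \<P>: "patch_partition M \<P>" and A: "finite A" "\<And>i. i \<in> A \<Longrightarrow> k i \<in> elements M"
  shows "sum f A = (\<Sum>P\<in>\<P>. sum f {i \<in> A. k i \<subseteq> P})"
proof -
  have "\<exists>P\<in>\<P>. k i \<subseteq> P" if "i \<in> A" for i
    using element_in_unique_patch[OF \<P> A(2)[OF that]] by blast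
  then have "A = (\<Union>P\<in>\<P>. {i \<in> A. k i \<subseteq> P})" by auto
  then have "sum f A = sum f (\<Union>P\<in>\<P>. {i \<in> A. k i \<subseteq> P})" by simp
  also have "\<dots> = (\<Sum>P\<in>\<P>. sum f {i \<in> A. k i \<subseteq> P})"
    using A(1) element_in_unique_patch[OF \<P> A(2)]
    by (intro sum.UNION_disjoint finite_patches[OF \<P>]) auto
  finally show ?thesis .
qed

lemma l2_norm_patches:
  assumes \<P>: "patch_partition M \<P>" and f: "f \<in> broken_space M"
  shows "(l2_norm (region M) (grad f))\<^sup>2 = (\<Sum>P\<in>\<P>. (l2_norm P (grad f))\<^sup>2)"
proof -
  let ?g = "\<lambda>x. grad f x \<bullet> grad f x"
  have ec: "elementwise_continuous M ?g"
    by (intro elementwise_continuous_inner continuous_intros elementwise_continuous_grad f)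
  have "(l2_norm (region M) (grad f))\<^sup>2 = (\<Sum>K\<in>elements M. LINT x:interior K|lebesgue. ?g x)"
    unfolding l2_norm_power2 by (intro l2_inner_elements elementwise_continuous_grad f)
  also have "\<dots> = (\<Sum>P\<in>\<P>. \<Sum>K\<in>{K \<in> elements M. K \<subseteq> P}. LINT x:interior K|lebesgue. ?g x)"
    by (rule sum_patches[OF \<P> finite_elements])
  also have "\<dots> = (\<Sum>P\<in>\<P>. (l2_norm P (grad f))\<^sup>2)"
  proof (rule sum.cong)
    fix P assume "P \<in> \<P>"
    then have "P = \<Union> {K \<in> elements M. K \<subseteq> P}" by (rule patch_union[OF \<P>])
    moreover have "(\<Union>K\<in>{K \<in> elements M. K \<subseteq> P}. interior K) \<subseteq> P" using interior_subset by blast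
    ultimately show "(\<Sum>K\<in>{K \<in> elements M. K \<subseteq> P}. LINT x:interior K|lebesgue. ?g x) =
        (l2_norm P (grad f))\<^sup>2"
      unfolding l2_norm_power2 l2_inner_def by (intro lint_union_elements[symmetric] ec) auto
  qed simp
  finally show ?thesis .
qed

end

section \<open>Energy balance of the splitting and the restart\<close>

text \<open>With relaxation time \<open>1 / r\<close> alone, the squared factor would be exactly
  \<open>1 - s\<close>, where \<open>s\<close> is the positive part of the energy ratio. The minimum
  with \<open>\<tau>rel\<close> shortens the time and so only lowers the factor.\<close>

lemma relax_factor_energy_bound:
  assumes "0 \<le> Ek" "dE < Ek" "0 < \<tau>" "0 < \<tau>rel"
  shows "((relax_factor \<tau> (relax_time \<tau>rel (relax_rate \<tau> dE Ek)))\<^sup>2 - 1) * Ek + dE \<le> 0"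
\<comment> \<open>If \<open>Ek = 0\<close>, the product vanishes and \<open>dE < Ek\<close> makes
  \<open>dE\<close> negative, whatever value the quotient has by convention.\<close>
proof (cases "Ek = 0")
  case False
  define s where "s = max (dE / Ek) 0"
  define r where "r = relax_rate \<tau> dE Ek"
  define T where "T = relax_time \<tau>rel r"
  have Ek: "Ek > 0" using False assms by simp
  then have s: "0 \<le> s" "s < 1" "dE \<le> s * Ek"
    using assms by (auto simp: s_def pos_divide_le_eq[symmetric])
  have r: "0 \<le> r"
    unfolding r_def relax_rate_def s_def[symmetric] using assms s
    by (simp add: divide_nonpos_pos)
  have T: "0 < T" "T \<le> inverse (ereal r)"
    using assms r by (auto simp: T_def relax_time_def)
  have "\<tau> * r \<le> real_of_ereal (ereal \<tau> / T)"
  proof (cases T)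
    case (real t)
    then have t: "0 < t" using T by simp
    have "r * t \<le> 1"
    proof (cases "r = 0")
      case False
      then have "t \<le> 1 / r" using T(2) real by (simp add: inverse_eq_divide)
      then show ?thesis using False r by (simp add: field_simps)
    qed simp
    then have "\<tau> * (r * t) \<le> \<tau>" using assms by simp
    then show ?thesis using real t by (simp add: field_simps)
  next
    \<comment> \<open>An infinite relaxation time forces the inverse of \<open>r\<close> to be
      infinite, hence \<open>r = 0\<close>, and both sides are 0.\<close>
    case PInf
    then have "r = 0" using T(2) by (cases "r = 0") auto
    then show ?thesis using PInf by simp
  qed (use T in auto)
  then have "relax_factor \<tau> T \<le> exp (- (\<tau> * r))" by (simp add: relax_factor_def)
  then have "(relax_factor \<tau> T)\<^sup>2 \<le> (exp (- (\<tau> * r)))\<^sup>2"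
    by (intro power_mono) (auto simp: relax_factor_def)
  \<comment> \<open>Squaring doubles the exponent, which the factor 1/2 in \<open>relax_rate\<close>
    undoes.\<close>
  also have "\<dots> = exp (ln (1 - s))"
    using assms by (simp add: exp_double[symmetric] r_def relax_rate_def s_def)
  also have "\<dots> = 1 - s" using s by simp
  finally have "((relax_factor \<tau> T)\<^sup>2 - 1) * Ek \<le> (- s) * Ek"
    using Ek by (intro mult_right_mono) auto
  then show ?thesis using s(3) by (simp add: T_def r_def)
qed (use assms in simp)

text \<open>The update adds to \<open>ener\<close> precisely the change of kinetic energy, so the
  internal energy at each node is unchanged. This permits the second hyperbolic update of the Strang
  splitting and keeps densities positive for the restart.\<close>

lemma source_update_admissible:
  assumes "source_update M bc \<alpha> \<tau> U \<phi> U' \<phi>'" "admissible M U"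
  shows "admissible M U'"
  unfolding admissible_def
proof
  fix i assume i: "i \<in> nodes M"
  have "dens U' i = dens U i" "ener U' i = ener U i +
      1 / (2 * dens U' i) * ((norm (mom U' i))\<^sup>2 - (norm (mom U i))\<^sup>2)"
    using assms(1) i unfolding source_update_def Let_def by blast+
  moreover have "dens U i > 0" "ener U i - (norm (mom U i))\<^sup>2 / (2 * dens U i) > 0"
    using assms(2) i unfolding admissible_def by blast+
  ultimately show "dens U' i > 0 \<and> ener U' i - (norm (mom U' i))\<^sup>2 / (2 * dens U' i) > 0"
    by (simp add: diff_divide_distrib)
qed

context fe_mesh
begin

lemma split_step_energy:
  assumes split: "split_step M bc \<alpha> hyp \<tau> spl U \<phi> U1 \<phi>1" and "\<alpha> \<noteq> 0"
    and hyp: "hyperbolic_update M (hyp \<tau>)" and U: "admissible M U"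
    and \<phi>: "\<phi> \<in> potential_space M bc"
  shows "admissible M U1" "\<phi>1 \<in> potential_space M bc"
    and "(\<Sum>i\<in>nodes M. mass M i * ener U1 i) + 1 / (2 * \<alpha>) * (l2_norm (region M) (grad \<phi>1))\<^sup>2
       = (\<Sum>i\<in>nodes M. mass M i * ener U i) + 1 / (2 * \<alpha>) * (l2_norm (region M) (grad \<phi>))\<^sup>2"
proof -
  have H: "admissible M (hyp \<tau> W)"
    "(\<Sum>i\<in>nodes M. mass M i * ener (hyp \<tau> W) i) = (\<Sum>i\<in>nodes M. mass M i * ener W i)"
    if "admissible M W" for W
    using hyp that unfolding hyperbolic_update_def by blast+
  \<comment> \<open>The source balance is exact for every step size, so the doubled step of Strang
    needs no separate treatment. The splittings then differ only in whether a further hyperbolic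
    update, which conserves total nodal energy, follows.\<close>
  obtain \<tau>' U2 where src: "source_update M bc \<alpha> \<tau>' (hyp \<tau> U) \<phi> U2 \<phi>1"
    and U1: "U1 = U2 \<or> U1 = hyp \<tau> U2"
    using split by (cases spl) auto
  have U2: "admissible M U2" using source_update_admissible[OF src H(1)[OF U]] .
  show "\<phi>1 \<in> potential_space M bc" using src unfolding source_update_def Let_def by blast
  show "admissible M U1" using U1 U2 H(1) by blast
  have "(\<Sum>i\<in>nodes M. mass M i * ener U1 i) = (\<Sum>i\<in>nodes M. mass M i * ener U2 i)"
    using U1 H(2)[OF U2] by auto
  moreover have "dens (hyp \<tau> U) i > 0" if "i \<in> nodes M" for i
    using H(1)[OF U] that unfolding admissible_def by blast
  ultimately show "(\<Sum>i\<in>nodes M. mass M i * ener U1 i) + 1 / (2 * \<alpha>) * (l2_norm (region M) (grad \<phi>1))\<^sup>2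
       = (\<Sum>i\<in>nodes M. mass M i * ener U i) + 1 / (2 * \<alpha>) * (l2_norm (region M) (grad \<phi>))\<^sup>2"
    using source_update_energy[OF src \<open>\<alpha> \<noteq> 0\<close> _ \<phi>] H(2)[OF U] by simp
qed

lemma restart_step_energy:
  assumes \<P>: "patch_partition M \<P>"
    and "0 < \<tau>" "0 < \<tau>rel"
    and U1: "admissible M U1" and "\<phi>1 \<in> potential_space M bc" "\<phi>t \<in> potential_space M bc"
    and Ut: "\<And>P i. P \<in> \<P> \<Longrightarrow> i \<in> patch_nodes M P \<Longrightarrow>
      mom Ut i = relax_factor \<tau>
        (relax_time \<tau>rel (relax_rate \<tau> (delta_E \<alpha> P \<phi>t \<phi>1) (E_kin M U1 P))) *\<^sub>R mom U1 i \<and>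
      ener Ut i = ener U1 i +
        1 / (2 * dens U1 i) * ((norm (mom Ut i))\<^sup>2 - (norm (mom U1 i))\<^sup>2)"
    and small: "\<And>P. P \<in> \<P> \<Longrightarrow> delta_E \<alpha> P \<phi>t \<phi>1 < E_kin M U1 P"
  shows "(\<Sum>i\<in>nodes M. mass M i * ener Ut i) + 1 / (2 * \<alpha>) * (l2_norm (region M) (grad \<phi>t))\<^sup>2
       \<le> (\<Sum>i\<in>nodes M. mass M i * ener U1 i) + 1 / (2 * \<alpha>) * (l2_norm (region M) (grad \<phi>1))\<^sup>2"
proof -
  have br: "\<phi>1 \<in> broken_space M" "\<phi>t \<in> broken_space M"
    using assms(5,6) potential_space_subset by blast+
  define F where "F P = relax_factor \<tau> (relax_time \<tau>rel (relax_rate \<tau> (delta_E \<alpha> P \<phi>t \<phi>1) (E_kin M U1 P)))" for P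
  have kin: "(\<Sum>i\<in>patch_nodes M P. mass M i * (ener Ut i - ener U1 i)) =
      ((F P)\<^sup>2 - 1) * E_kin M U1 P" if P: "P \<in> \<P>" for P
    unfolding E_kin_def sum_distrib_left
  proof (rule sum.cong)
    fix i assume i: "i \<in> patch_nodes M P"
    show "mass M i * (ener Ut i - ener U1 i) =
        ((F P)\<^sup>2 - 1) * (mass M i * ((norm (mom U1 i))\<^sup>2 / (2 * dens U1 i)))"
    proof -
      have m: "mom Ut i = F P *\<^sub>R mom U1 i" and e: "ener Ut i = ener U1 i +
          1 / (2 * dens U1 i) * ((norm (mom Ut i))\<^sup>2 - (norm (mom U1 i))\<^sup>2)"
        using Ut[OF P i] unfolding F_def[symmetric] by blast+
      show ?thesis
        unfolding e m norm_scaleR power_mult_distrib power2_abs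
        by (simp add: algebra_simps diff_divide_distrib)
    qed
  qed simp
  have "(\<Sum>i\<in>nodes M. mass M i * (ener Ut i - ener U1 i)) =
      (\<Sum>P\<in>\<P>. \<Sum>i\<in>patch_nodes M P. mass M i * (ener Ut i - ener U1 i))"
    unfolding patch_nodes_def by (rule sum_patches[OF \<P> finite_nodes nodes_element])
  then have kinetic: "(\<Sum>i\<in>nodes M. mass M i * (ener Ut i - ener U1 i)) =
      (\<Sum>P\<in>\<P>. ((F P)\<^sup>2 - 1) * E_kin M U1 P)"
    by (simp add: kin)
  have field: "1 / (2 * \<alpha>) * ((l2_norm (region M) (grad \<phi>t))\<^sup>2 - (l2_norm (region M) (grad \<phi>1))\<^sup>2) =
      (\<Sum>P\<in>\<P>. delta_E \<alpha> P \<phi>t \<phi>1)"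
    unfolding l2_norm_patches[OF \<P> br(1)] l2_norm_patches[OF \<P> br(2)] delta_E_def
    by (simp only: sum_distrib_left sum_subtractf[symmetric])
  \<comment> \<open>Both changes are now sums over the same patches, so kinetic loss and field gain
    can be compared patch by patch.\<close>
  have "(\<Sum>i\<in>nodes M. mass M i * (ener Ut i - ener U1 i)) +
      1 / (2 * \<alpha>) * ((l2_norm (region M) (grad \<phi>t))\<^sup>2 - (l2_norm (region M) (grad \<phi>1))\<^sup>2) =
      (\<Sum>P\<in>\<P>. ((F P)\<^sup>2 - 1) * E_kin M U1 P + delta_E \<alpha> P \<phi>t \<phi>1)"
    unfolding kinetic field sum.distrib ..
  also have "\<dots> \<le> 0"
    unfolding F_def
  proof (intro sum_nonpos relax_factor_energy_bound small)
    show "0 \<le> E_kin M U1 P" for P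
      unfolding E_kin_def
      using U1 by (intro sum_nonneg mult_nonneg_nonneg divide_nonneg_pos)
        (auto simp: patch_nodes_def admissible_def mass_nonneg)
  qed (use assms in auto)
  finally show ?thesis
    by (simp add: right_diff_distrib sum_subtractf)
qed

end

theorem lemma4p2:
  fixes M :: "'a::euclidean_space mesh"
    and bc :: "'a potential_bc"
    and \<P> :: "'a set set"
    and \<alpha> \<tau>n :: real
    and \<tau>rel :: ereal
    and \<rho>b :: "'a \<Rightarrow> real"
    and hyp :: "real \<Rightarrow> 'a flow \<Rightarrow> 'a flow"
    and spl :: splitting
    and U U1 Ut :: "'a flow"
    and \<phi> \<phi>1 \<phi>t :: "'a \<Rightarrow> real"
  assumes "is_mesh M"
    and "patch_partition M \<P>"
    and "\<alpha> \<noteq> 0"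
    and "\<tau>n > 0"
    and "\<tau>rel > 0"
    and "elementwise_continuous M \<rho>b"
    and "hyperbolic_update M (hyp \<tau>n)"
    and "admissible M U"
    and "\<phi> \<in> potential_space M bc"
    and "restart_step M bc \<alpha> \<rho>b \<tau>rel \<P> hyp \<tau>n spl U \<phi> U1 \<phi>1 Ut \<phi>t"
    and "\<forall>P\<in>\<P>. delta_E \<alpha> P \<phi>t \<phi>1 < E_kin M U1 P"
  shows "(\<Sum>i\<in>nodes M. mass M i * ener Ut i) + 1 / (2 * \<alpha>) * (l2_norm (region M) (grad \<phi>t))\<^sup>2
       \<le> (\<Sum>i\<in>nodes M. mass M i * ener U i) + 1 / (2 * \<alpha>) * (l2_norm (region M) (grad \<phi>))\<^sup>2"
proof -
  interpret fe_mesh M by unfold_locales (rule assms(1))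
  have split: "split_step M bc \<alpha> hyp \<tau>n spl U \<phi> U1 \<phi>1"
    and gauss: "gauss_law M bc \<alpha> \<rho>b (dens U1) \<phi>t"
    and Ut: "\<And>P i. P \<in> \<P> \<Longrightarrow> i \<in> patch_nodes M P \<Longrightarrow>
      mom Ut i = relax_factor \<tau>n
        (relax_time \<tau>rel (relax_rate \<tau>n (delta_E \<alpha> P \<phi>t \<phi>1) (E_kin M U1 P))) *\<^sub>R mom U1 i \<and>
      ener Ut i = ener U1 i +
        1 / (2 * dens U1 i) * ((norm (mom Ut i))\<^sup>2 - (norm (mom U1 i))\<^sup>2)"
    using assms(10) unfolding restart_step_def by blast+
  note energy = split_step_energy[OF split assms(3,7-9)]
  have "\<phi>t \<in> potential_space M bc" using gauss unfolding gauss_law_def by blast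
  from restart_step_energy[OF assms(2,4,5) energy(1,2) this Ut] assms(11) energy(3)
  show ?thesis by simp
qed

end
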